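(* Let $p$ be a prime, $g\ge1$ an integer, $q=p^g$ and $G=GL_2(\mathbb{F}_q)$. For any $k,h,i\in\mathbb{Z}$ the following identity holds in the Grothendieck ring $K_0(G)$: $$M_k^{[i]}M_h^{[i+1]}-e^{p^{i+1}}M_{k-p}^{[i]}M_{h-1}^{[i+1]}=M_{k-p}^{[i]}M_{h+1}^{[i+1]}-e^{p^{i+1}}M_{k-2p}^{[i]}M_h^{[i+1]}.$$
   Context: $K_0(G)$ is the Grothendieck group of finitely generated $\mathbb{F}_q[G]$-modules, a commutative ring with product induced by tensor product over $\mathbb{F}_q$; $e$ denotes the class of the determinant character $\det:G\to\mathbb{F}_q^\times$ (so $e^{q-1}=1$). For $k\ge0$, $M_k$ is (the class of) $\mathrm{Sym}^k\mathbb{F}_q^2$, the $k$-th symmetric power of the standard representation ($M_0$ trivial). For $k<0$, $M_k\in K_0(G)$ is defined by $M_{-1}=0$ and $M_k=-e^{1+k}M_{-k-2}$ for $k\le-2$. For $n\in\mathbb{Z}$, the superscript $[n]$ denotes the $n$-th Frobenius twist: the $G$-action is precomposed with the automorphism of $G$ applying the $n$-th power of the Frobenius $x\mapsto x^p$ to matrix entries; it extends to a ring automorphism of $K_0(G)$. For any $n\in\mathbb{Z}$, $e^{p^n}$ denotes $e^{[n]}$ (for negative $n$ the exponent is read modulo $q-1$). *)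

theory Defs
  imports
    "HOL-Library.Cardinality"
    "HOL-Library.Poly_Mapping"
    "HOL-Algebra.Group"
    "Jordan_Normal_Form.Matrix_Kernel"
begin

section \<open>Representations of \<open>GL\<^sub>2\<close> over a finite field\<close>

definition GL :: "nat \<Rightarrow> 'a::finite_field mat monoid" where
  "GL n = units_of (ring_mat TYPE('a) n ())"

text \<open>
  A finitely generated module over the group algebra of \<open>GL\<^sub>2(\<F>\<^sub>q)\<close> is a finite-dimensional
  representation of \<open>GL\<^sub>2(\<F>\<^sub>q)\<close>.  After the choice of a basis it is given by its dimension \<open>n\<close> and
  a group homomorphism to \<open>GL\<^sub>n(\<F>\<^sub>q)\<close>, acting on column vectors.  The values of that map outside
  \<open>GL\<^sub>2(\<F>\<^sub>q)\<close> are irrelevant: representations that agree on \<open>GL\<^sub>2(\<F>\<^sub>q)\<close> are isomorphic and hence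
  have the same class in the Grothendieck group.
\<close>

typedef (overloaded) ('a::finite_field) GL2_rep =
    "{(n, \<rho> :: 'a mat \<Rightarrow> 'a mat). \<rho> \<in> hom (GL 2) (GL n)}"
  morphisms rep_pair Abs_GL2_rep
proof
  show "(0, \<lambda>_. 1\<^sub>m 0) \<in> {(n, \<rho> :: 'a mat \<Rightarrow> 'a mat). \<rho> \<in> hom (GL 2) (GL n)}"
    by (auto simp: hom_def GL_def units_of_def Units_def ring_mat_simps intro!: bexI[of _ "1\<^sub>m 0"])
qed

definition rdim :: "'a::finite_field GL2_rep \<Rightarrow> nat" where
  "rdim V = fst (rep_pair V)"

definition ract :: "'a::finite_field GL2_rep \<Rightarrow> 'a mat \<Rightarrow> 'a mat" where
  "ract V = snd (rep_pair V)"

lemma carrier_GL: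
  "A \<in> carrier (GL n) \<longleftrightarrow>
     A \<in> carrier_mat n n \<and> (\<exists>B\<in>carrier_mat n n. B * A = 1\<^sub>m n \<and> A * B = 1\<^sub>m n)"
  by (auto simp: GL_def units_of_def Units_def ring_mat_simps)

lemma carrier_GL_det: "A \<in> carrier (GL n) \<longleftrightarrow> A \<in> carrier_mat n n \<and> det A \<noteq> 0"
proof
  assume "A \<in> carrier (GL n)"
  then show "A \<in> carrier_mat n n \<and> det A \<noteq> 0"
    using unit_imp_det_non_zero[of A n "()"]
    by (auto simp: GL_def units_of_def Units_def ring_mat_simps)
next
  assume "A \<in> carrier_mat n n \<and> det A \<noteq> 0"
  then show "A \<in> carrier (GL n)"
    using det_non_zero_imp_unit[of A n "()"] by (auto simp: GL_def units_of_def)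
qed

lemma mult_GL: "A \<otimes>\<^bsub>GL n\<^esub> B = A * B"
  by (simp add: GL_def units_of_def ring_mat_simps)

lemma one_GL: "\<one>\<^bsub>GL n\<^esub> = 1\<^sub>m n"
  by (simp add: GL_def units_of_def ring_mat_simps)

lemma one_in_GL: "1\<^sub>m n \<in> carrier (GL n)"
  by (auto simp: carrier_GL intro!: bexI[of _ "1\<^sub>m n"])

lemma mult_in_GL:
  assumes "A \<in> carrier (GL n)" "B \<in> carrier (GL n)"
  shows "A * B \<in> carrier (GL n)"
  using assms det_mult[of A n B] by (auto simp: carrier_GL_det)

lemma GL_homI:
  assumes carr: "\<And>A. A \<in> carrier (GL 2) \<Longrightarrow> \<rho> A \<in> carrier_mat n n"
    and one: "\<rho> (1\<^sub>m 2) = 1\<^sub>m n"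
    and mult: "\<And>A B. A \<in> carrier (GL 2) \<Longrightarrow> B \<in> carrier (GL 2) \<Longrightarrow> \<rho> (A * B) = \<rho> A * \<rho> B"
  shows "\<rho> \<in> hom (GL 2) (GL n)"
proof -
  have "\<rho> A \<in> carrier (GL n)" if A: "A \<in> carrier (GL 2)" for A
  proof -
    obtain B where B: "B \<in> carrier_mat 2 2" "B * A = 1\<^sub>m 2" "A * B = 1\<^sub>m 2"
      using A by (auto simp: carrier_GL)
    have B': "B \<in> carrier (GL 2)" using A B by (auto simp: carrier_GL)
    show ?thesis
      using mult[OF A B'] mult[OF B' A] carr[OF A] carr[OF B'] B one by (auto simp: carrier_GL)
  qed
  then show ?thesis using mult by (auto simp: hom_def mult_GL)
qed

lemma ract_carrier_GL:
  fixes V :: "'a::finite_field GL2_rep"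
  assumes "A \<in> carrier (GL 2)"
  shows "ract V A \<in> carrier (GL (rdim V))"
  using assms rep_pair[of V] by (auto simp: hom_def rdim_def ract_def)

lemma ract_carrier:
  fixes V :: "'a::finite_field GL2_rep"
  assumes "A \<in> carrier (GL 2)"
  shows "ract V A \<in> carrier_mat (rdim V) (rdim V)"
  using ract_carrier_GL[OF assms] by (simp add: carrier_GL)

lemma ract_mult:
  fixes V :: "'a::finite_field GL2_rep"
  assumes "A \<in> carrier (GL 2)" "B \<in> carrier (GL 2)"
  shows "ract V (A * B) = ract V A * ract V B"
  using assms rep_pair[of V] by (auto simp: hom_def rdim_def ract_def mult_GL)

lemma ract_one: "ract V (1\<^sub>m 2) = 1\<^sub>m (rdim V)"
proof -
  let ?E = "ract V (1\<^sub>m 2)"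
  have E: "?E \<in> carrier_mat (rdim V) (rdim V)" "?E * ?E = ?E"
    using ract_mult[OF one_in_GL one_in_GL, of V] ract_carrier[OF one_in_GL] by auto
  obtain B where B: "B \<in> carrier_mat (rdim V) (rdim V)" "B * ?E = 1\<^sub>m (rdim V)"
    using ract_carrier_GL[OF one_in_GL, of V] by (auto simp: carrier_GL)
  have "B * (?E * ?E) = (B * ?E) * ?E" using B(1) E(1) by (metis assoc_mult_mat)
  then show ?thesis using B E by auto
qed

lemma rep_eqI: "rdim V = rdim W \<Longrightarrow> ract V = ract W \<Longrightarrow> V = W"
  by (metis prod_eqI rdim_def ract_def rep_pair_inject)

text \<open>Only meaningful for homomorphisms \<open>\<rho>\<close>; this is verified for each use below.\<close>

definition mk_rep :: "nat \<Rightarrow> ('a mat \<Rightarrow> 'a mat) \<Rightarrow> 'a::finite_field GL2_rep" where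
  "mk_rep n \<rho> = Abs_GL2_rep (n, \<rho>)"

lemma mk_rep:
  assumes "\<rho> \<in> hom (GL 2) (GL n)"
  shows "rdim (mk_rep n \<rho>) = n" "ract (mk_rep n \<rho>) = \<rho>"
  using assms by (simp_all add: mk_rep_def rdim_def ract_def Abs_GL2_rep_inverse)

text \<open>Short exact sequences \<open>0 \<rightarrow> U \<rightarrow> V \<rightarrow> W \<rightarrow> 0\<close>\<close>

definition intertwiner :: "'a::finite_field GL2_rep \<Rightarrow> 'a GL2_rep \<Rightarrow> 'a mat \<Rightarrow> bool" where
  "intertwiner V W T \<longleftrightarrow> T \<in> carrier_mat (rdim W) (rdim V) \<and>
     (\<forall>A\<in>carrier (GL 2). T * ract V A = ract W A * T)"

definition short_exact ::
    "'a::finite_field GL2_rep \<Rightarrow> 'a GL2_rep \<Rightarrow> 'a GL2_rep \<Rightarrow> bool" where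
  "short_exact U V W \<longleftrightarrow> (\<exists>P Q. intertwiner U V P \<and> intertwiner V W Q \<and>
     inj_on ((*\<^sub>v) P) (carrier_vec (rdim U)) \<and>
     (*\<^sub>v) P ` carrier_vec (rdim U) = mat_kernel Q \<and>
     (*\<^sub>v) Q ` carrier_vec (rdim V) = carrier_vec (rdim W))"

text \<open>Every short exact sequence splits over the field, which reduces exactness to matrix identities.\<close>

definition mat_split :: "nat \<Rightarrow> nat \<Rightarrow> nat \<Rightarrow> 'a::field mat \<Rightarrow> 'a mat \<Rightarrow> 'a mat \<Rightarrow> 'a mat \<Rightarrow> bool" where
  "mat_split l n m P Q P' Q' \<longleftrightarrow>
     P \<in> carrier_mat n l \<and> Q \<in> carrier_mat m n \<and> P' \<in> carrier_mat l n \<and> Q' \<in> carrier_mat n m \<and>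
     P' * P = 1\<^sub>m l \<and> Q * Q' = 1\<^sub>m m \<and> P * P' + Q' * Q = 1\<^sub>m n \<and> Q * P = 0\<^sub>m m l \<and> P' * Q' = 0\<^sub>m l m"

lemma mat_vec_eqI:
  fixes A B :: "'a::field mat"
  assumes A: "A \<in> carrier_mat n m" and B: "B \<in> carrier_mat n m"
    and eq: "\<And>v. v \<in> carrier_vec m \<Longrightarrow> A *\<^sub>v v = B *\<^sub>v v"
  shows "A = B"
proof (rule eq_matI)
  fix i j assume ij: "i < dim_row B" "j < dim_col B"
  have "(A *\<^sub>v unit_vec m j) $ i = (B *\<^sub>v unit_vec m j) $ i" by (simp add: eq)
  then show "A $$ (i, j) = B $$ (i, j)" using A B ij by auto
qed (use A B in auto)

lemma zero_mult_mat_vec: "v \<in> carrier_vec m \<Longrightarrow> 0\<^sub>m n m *\<^sub>v v = (0\<^sub>v n :: 'a::field vec)"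
  by (intro eq_vecI) auto

lemma mat_mult_unit_vec:
  fixes A :: "'a::field mat"
  assumes "A \<in> carrier_mat n m" "j < m"
  shows "A *\<^sub>v unit_vec m j = col A j"
  using assms by (intro eq_vecI) auto

lemma mat_of_cols_mult_unit:
  fixes f :: "nat \<Rightarrow> 'a::field vec"
  assumes "\<And>j. j < m \<Longrightarrow> f j \<in> carrier_vec n" "j < m"
  shows "col (mat n m (\<lambda>(i,j). f j $ i)) j = f j"
  using assms(2) assms(1)[OF assms(2)] by (intro eq_vecI) auto

lemma exact_imp_split:
  fixes P Q :: "'a::field mat"
  assumes P: "P \<in> carrier_mat n l" and Q: "Q \<in> carrier_mat m n"
    and inj: "inj_on ((*\<^sub>v) P) (carrier_vec l)"
    and ex: "(*\<^sub>v) P ` carrier_vec l = mat_kernel Q"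
    and surj: "(*\<^sub>v) Q ` carrier_vec n = carrier_vec m"
  shows "\<exists>P' Q'. mat_split l n m P Q P' Q'"
proof -
  have "\<exists>v\<in>carrier_vec n. Q *\<^sub>v v = unit_vec m j" for j
    using surj unit_vec_carrier[of m j] by (metis imageE)
  then obtain q where q: "\<And>j. q j \<in> carrier_vec n" "\<And>j. Q *\<^sub>v q j = unit_vec m j" by metis
  define Q' where "Q' = mat n m (\<lambda>(i,j). q j $ i)"
  have Q': "Q' \<in> carrier_mat n m" by (simp add: Q'_def)
  have QQ': "Q * Q' = 1\<^sub>m m"
  proof (rule mat_col_eqI)
    fix j assume j: "j < dim_col (1\<^sub>m m :: 'a mat)"
    have "col (Q * Q') j = Q *\<^sub>v col Q' j" using Q Q' j by auto
    also have "col Q' j = q j" unfolding Q'_def using q j by (intro mat_of_cols_mult_unit) auto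
    finally show "col (Q * Q') j = col (1\<^sub>m m) j" using q j by simp
  qed (use Q Q' in auto)
  let ?R = "1\<^sub>m n - Q' * Q"
  have R: "?R \<in> carrier_mat n n" using Q Q' by auto
  have QR: "Q * ?R = 0\<^sub>m m n"
  proof -
    have "Q * ?R = Q * 1\<^sub>m n - Q * (Q' * Q)"
      using Q Q' by (intro mult_minus_distrib_mat) auto
    also have "Q * (Q' * Q) = (Q * Q') * Q" using Q Q' by (metis assoc_mult_mat)
    finally show ?thesis using Q by (simp add: QQ')
  qed
  have "\<exists>w\<in>carrier_vec l. P *\<^sub>v w = ?R *\<^sub>v v" if v: "v \<in> carrier_vec n" for v
  proof -
    have "Q *\<^sub>v (?R *\<^sub>v v) = (Q * ?R) *\<^sub>v v" using Q R v by (metis assoc_mult_mat_vec)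
    then have "?R *\<^sub>v v \<in> mat_kernel Q"
      using R v zero_mult_mat_vec[OF v, of m] unfolding QR mat_kernel[OF Q]
      by (metis (mono_tags, lifting) mem_Collect_eq mult_mat_vec_carrier)
    then show ?thesis using ex by (metis imageE)
  qed
  then obtain w where w: "\<And>v. v \<in> carrier_vec n \<Longrightarrow> w v \<in> carrier_vec l \<and> P *\<^sub>v w v = ?R *\<^sub>v v"
    by metis
  define P' where "P' = mat l n (\<lambda>(i,j). w (unit_vec n j) $ i)"
  have P': "P' \<in> carrier_mat l n" by (simp add: P'_def)
  have PP': "P * P' = ?R"
  proof (rule mat_col_eqI)
    fix j assume "j < dim_col ?R"
    then have j: "j < n" using Q by auto
    have "col (P * P') j = P *\<^sub>v col P' j" using P P' j by auto
    also have "col P' j = w (unit_vec n j)"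
      unfolding P'_def using w j by (intro mat_of_cols_mult_unit) auto
    finally have "col (P * P') j = ?R *\<^sub>v unit_vec n j" using w by simp
    also have "\<dots> = col ?R j" by (rule mat_mult_unit_vec[OF R j])
    finally show "col (P * P') j = col ?R j" .
  qed (use P P' Q Q' in auto)
  have sum: "P * P' + Q' * Q = 1\<^sub>m n"
    unfolding PP' using Q Q' by (intro eq_matI) auto
  have QP: "Q * P = 0\<^sub>m m l"
  proof (rule mat_vec_eqI)
    fix v :: "'a vec" assume v: "v \<in> carrier_vec l"
    have "P *\<^sub>v v \<in> mat_kernel Q" using ex v by blast
    then show "(Q * P) *\<^sub>v v = 0\<^sub>m m l *\<^sub>v v"
      using P Q v mat_kernelD(2)[OF Q] by (auto simp: assoc_mult_mat_vec[OF Q P])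
  qed (use P Q in auto)
  have P'P: "P' * P = 1\<^sub>m l"
  proof (rule mat_vec_eqI)
    fix v :: "'a vec" assume v: "v \<in> carrier_vec l"
    have "P * (P' * P) = (P * P') * P" using P P' by (metis assoc_mult_mat)
    also have "\<dots> = 1\<^sub>m n * P - Q' * Q * P"
      unfolding PP' using P Q Q' by (intro minus_mult_distrib_mat) auto
    also have "Q' * Q * P = Q' * (Q * P)" using P Q Q' by (metis assoc_mult_mat)
    also have "1\<^sub>m n * P - \<dots> = P" unfolding QP using P Q' by (intro eq_matI) auto
    finally have "P * (P' * P) = P" .
    then have "P *\<^sub>v ((P' * P) *\<^sub>v v) = P *\<^sub>v v"
      using P P' v by (metis assoc_mult_mat_vec mult_carrier_mat)
    then show "(P' * P) *\<^sub>v v = 1\<^sub>m l *\<^sub>v v"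
      using inj v P P' by (auto dest!: inj_onD)
  qed (use P P' in auto)
  have P'Q': "P' * Q' = 0\<^sub>m l m"
  proof -
    have "P' * Q' = (P' * P) * (P' * Q')" using P P' Q' by (simp add: P'P)
    also have "\<dots> = P' * ((P * P') * Q')" using P P' Q'
      by (smt (verit) assoc_mult_mat mult_carrier_mat)
    also have "(P * P') * Q' = 1\<^sub>m n * Q' - Q' * Q * Q'"
      unfolding PP' using P Q Q' by (intro minus_mult_distrib_mat) auto
    also have "Q' * Q * Q' = Q' * (Q * Q')" using Q Q' by (metis assoc_mult_mat)
    also have "1\<^sub>m n * Q' - \<dots> = 0\<^sub>m n m" unfolding QQ' using Q' by (intro eq_matI) auto
    finally show ?thesis using P' by simp
  qed
  show ?thesis using P Q P' Q' QQ' sum QP P'P P'Q' unfolding mat_split_def by blast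
qed

lemma split_imp_exact:
  fixes P Q :: "'a::field mat"
  assumes "mat_split l n m P Q P' Q'"
  shows "inj_on ((*\<^sub>v) P) (carrier_vec l)"
    and "(*\<^sub>v) P ` carrier_vec l = mat_kernel Q"
    and "(*\<^sub>v) Q ` carrier_vec n = carrier_vec m"
proof -
  have carr: "P \<in> carrier_mat n l" "Q \<in> carrier_mat m n" "P' \<in> carrier_mat l n" "Q' \<in> carrier_mat n m"
    and eqs: "P' * P = 1\<^sub>m l" "Q * Q' = 1\<^sub>m m" "P * P' + Q' * Q = 1\<^sub>m n" "Q * P = 0\<^sub>m m l"
    using assms by (auto simp: mat_split_def)
  have P'P: "P' *\<^sub>v (P *\<^sub>v v) = v" if "v \<in> carrier_vec l" for v
    using that carr eqs by (metis assoc_mult_mat_vec one_mult_mat_vec)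
  show "inj_on ((*\<^sub>v) P) (carrier_vec l)"
    by (rule inj_on_inverseI[of _ "(*\<^sub>v) P'"]) (rule P'P)
  show "(*\<^sub>v) Q ` carrier_vec n = carrier_vec m"
  proof
    show "carrier_vec m \<subseteq> (*\<^sub>v) Q ` carrier_vec n"
    proof
      fix v :: "'a vec" assume v: "v \<in> carrier_vec m"
      have "v = Q *\<^sub>v (Q' *\<^sub>v v)"
        using v carr eqs by (metis assoc_mult_mat_vec one_mult_mat_vec)
      then show "v \<in> (*\<^sub>v) Q ` carrier_vec n" using carr v by (intro image_eqI[of _ _ "Q' *\<^sub>v v"]) auto
    qed
  qed (use carr in auto)
  show "(*\<^sub>v) P ` carrier_vec l = mat_kernel Q"
  proof
    show "(*\<^sub>v) P ` carrier_vec l \<subseteq> mat_kernel Q"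
    proof
      fix x assume "x \<in> (*\<^sub>v) P ` carrier_vec l"
      then obtain v where v: "v \<in> carrier_vec l" "x = P *\<^sub>v v" by blast
      have "Q *\<^sub>v x = 0\<^sub>m m l *\<^sub>v v" using v carr eqs by (metis assoc_mult_mat_vec)
      then show "x \<in> mat_kernel Q" using v carr by (intro mat_kernelI[of _ m n]) auto
    qed
    show "mat_kernel Q \<subseteq> (*\<^sub>v) P ` carrier_vec l"
    proof
      fix x assume "x \<in> mat_kernel Q"
      then have x: "x \<in> carrier_vec n" "Q *\<^sub>v x = 0\<^sub>v m" using mat_kernelD[of Q m n] carr by auto
      have "x = (P * P' + Q' * Q) *\<^sub>v x" using x eqs by simp
      also have "\<dots> = (P * P') *\<^sub>v x + (Q' * Q) *\<^sub>v x"
        using carr x by (intro add_mult_distrib_mat_vec) auto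
      also have "(Q' * Q) *\<^sub>v x = Q' *\<^sub>v (Q *\<^sub>v x)" using carr x by (metis assoc_mult_mat_vec)
      also have "\<dots> = 0\<^sub>v n" using carr by (auto simp: x)
      also have "(P * P') *\<^sub>v x = P *\<^sub>v (P' *\<^sub>v x)" using carr x by (metis assoc_mult_mat_vec)
      finally have "x = P *\<^sub>v (P' *\<^sub>v x)" using carr x by auto
      then show "x \<in> (*\<^sub>v) P ` carrier_vec l" using carr x by (intro image_eqI[of _ _ "P' *\<^sub>v x"]) auto
    qed
  qed
qed

lemma short_exact_split:
  "short_exact U V W \<longleftrightarrow> (\<exists>P Q P' Q'. intertwiner U V P \<and> intertwiner V W Q \<and>
     mat_split (rdim U) (rdim V) (rdim W) P Q P' Q')"
proof
  assume "short_exact U V W"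
  then show "\<exists>P Q P' Q'. intertwiner U V P \<and> intertwiner V W Q \<and>
     mat_split (rdim U) (rdim V) (rdim W) P Q P' Q'"
    unfolding short_exact_def using exact_imp_split by (metis intertwiner_def)
next
  assume "\<exists>P Q P' Q'. intertwiner U V P \<and> intertwiner V W Q \<and>
     mat_split (rdim U) (rdim V) (rdim W) P Q P' Q'"
  then show "short_exact U V W"
    unfolding short_exact_def using split_imp_exact by metis
qed

section \<open>Tensor products\<close>

definition kronecker :: "'a::semiring_0 mat \<Rightarrow> 'a mat \<Rightarrow> 'a mat" where
  "kronecker A B = mat (dim_row A * dim_row B) (dim_col A * dim_col B)
     (\<lambda>(i,j). A $$ (i div dim_row B, j div dim_col B) * B $$ (i mod dim_row B, j mod dim_col B))"

lemma div_less_prod: "k < m * n \<Longrightarrow> k div n < (m::nat)"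
  by (simp add: less_mult_imp_div_less)

lemma mod_less_prod: "k < m * n \<Longrightarrow> k mod n < (n::nat)"
  by (cases "n = 0") auto

lemma pair_less_prod:
  assumes "a < m" "b < (n::nat)"
  shows "a * n + b < m * n"
proof -
  have "a * n + b < Suc a * n" using assms by simp
  also have "\<dots> \<le> m * n" using assms by (intro mult_right_mono) auto
  finally show ?thesis .
qed

lemma sum_div_mod:
  fixes f :: "nat \<Rightarrow> nat \<Rightarrow> 'b::comm_monoid_add"
  shows "(\<Sum>k<m * n. f (k div n) (k mod n)) = (\<Sum>a<m. \<Sum>b<n. f a b)"
proof -
  have "(\<Sum>k<m * n. f (k div n) (k mod n)) = (\<Sum>(a, b)\<in>{..<m} \<times> {..<n}. f a b)"
    by (rule sum.reindex_bij_witness[of _ "\<lambda>(a,b). a * n + b" "\<lambda>k. (k div n, k mod n)"])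
       (auto simp: div_less_prod mod_less_prod pair_less_prod)
  then show ?thesis by (simp add: sum.cartesian_product)
qed

lemma kronecker_carrier [simp]:
  "A \<in> carrier_mat n m \<Longrightarrow> B \<in> carrier_mat n' m' \<Longrightarrow> kronecker A B \<in> carrier_mat (n * n') (m * m')"
  by (auto simp: kronecker_def)

lemma kronecker_index:
  assumes "A \<in> carrier_mat n m" "B \<in> carrier_mat n' m'" "i < n * n'" "j < m * m'"
  shows "kronecker A B $$ (i, j) = A $$ (i div n', j div m') * B $$ (i mod n', j mod m')"
  using assms by (auto simp: kronecker_def)

lemma mult_mat_index:
  assumes "A \<in> carrier_mat n m" "B \<in> carrier_mat m l" "i < n" "j < l"
  shows "(A * B) $$ (i, j) = (\<Sum>k<m. A $$ (i, k) * B $$ (k, j))"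
  using assms by (auto simp: scalar_prod_def atLeast0LessThan)

lemma kronecker_mult:
  fixes A :: "'a::comm_semiring_0 mat"
  assumes A: "A \<in> carrier_mat n m" and B: "B \<in> carrier_mat m l"
    and C: "C \<in> carrier_mat n' m'" and D: "D \<in> carrier_mat m' l'"
  shows "kronecker A C * kronecker B D = kronecker (A * B) (C * D)"
proof (rule eq_matI)
  have AB: "A * B \<in> carrier_mat n l" "C * D \<in> carrier_mat n' l'" using assms by auto
  have dims: "dim_row (kronecker (A * B) (C * D)) = n * n'" "dim_col (kronecker (A * B) (C * D)) = l * l'"
    using kronecker_carrier[OF AB] by auto
  fix i j assume "i < dim_row (kronecker (A * B) (C * D))" "j < dim_col (kronecker (A * B) (C * D))"
  then have ij: "i < n * n'" "j < l * l'" using dims by auto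
  have "(kronecker A C * kronecker B D) $$ (i, j)
        = (\<Sum>k<m * m'. kronecker A C $$ (i, k) * kronecker B D $$ (k, j))"
    using assms ij by (intro mult_mat_index) auto
  also have "\<dots> = (\<Sum>k<m * m'. (A $$ (i div n', k div m') * C $$ (i mod n', k mod m')) *
      (B $$ (k div m', j div l') * D $$ (k mod m', j mod l')))"
    using assms ij by (intro sum.cong refl) (simp add: kronecker_index[OF A C] kronecker_index[OF B D])
  also have "\<dots> = (\<Sum>a<m. \<Sum>b<m'. (A $$ (i div n', a) * C $$ (i mod n', b)) *
      (B $$ (a, j div l') * D $$ (b, j mod l')))"
    by (rule sum_div_mod)
  also have "\<dots> = (\<Sum>a<m. A $$ (i div n', a) * B $$ (a, j div l')) *
      (\<Sum>b<m'. C $$ (i mod n', b) * D $$ (b, j mod l'))"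
    by (simp add: sum_product algebra_simps)
  also have "\<dots> = (A * B) $$ (i div n', j div l') * (C * D) $$ (i mod n', j mod l')"
    using ij by (simp add: mult_mat_index[OF A B] mult_mat_index[OF C D] div_less_prod mod_less_prod
        del: index_mult_mat)
  also have "\<dots> = kronecker (A * B) (C * D) $$ (i, j)"
    by (simp add: kronecker_index[OF AB ij])
  finally show "(kronecker A C * kronecker B D) $$ (i, j) = kronecker (A * B) (C * D) $$ (i, j)" .
qed (use assms in \<open>auto simp: kronecker_def\<close>)

lemma kronecker_one: "kronecker (1\<^sub>m n) (1\<^sub>m m) = (1\<^sub>m (n * m) :: 'a::semiring_1 mat)"
proof (rule eq_matI)
  fix i j assume "i < dim_row (1\<^sub>m (n * m) :: 'a mat)" "j < dim_col (1\<^sub>m (n * m) :: 'a mat)"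
  then have ij: "i < n * m" "j < n * m" by auto
  have "(i div m = j div m \<and> i mod m = j mod m) = (i = j)" by (metis div_mult_mod_eq)
  then show "kronecker (1\<^sub>m n) (1\<^sub>m m) $$ (i, j) = (1\<^sub>m (n * m) :: 'a mat) $$ (i, j)"
    using ij kronecker_index[OF one_carrier_mat one_carrier_mat ij]
    by (auto simp: div_less_prod mod_less_prod)
qed (auto simp: kronecker_def)

lemma kronecker_add_left:
  assumes "A \<in> carrier_mat n m" "B \<in> carrier_mat n m"
  shows "kronecker (A + B) C = kronecker A C + kronecker B C"
  using assms
  by (intro eq_matI) (auto simp: kronecker_def algebra_simps div_less_prod)

lemma kronecker_zero_left: "kronecker (0\<^sub>m n m) C = 0\<^sub>m (n * dim_row C) (m * dim_col C)"
  by (intro eq_matI) (auto simp: kronecker_def div_less_prod)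

lemma kronecker_assoc:
  fixes A :: "'a::comm_semiring_0 mat"
  shows "kronecker (kronecker A B) C = kronecker A (kronecker B C)"
proof (rule eq_matI)
  fix i j
  assume "i < dim_row (kronecker A (kronecker B C))" "j < dim_col (kronecker A (kronecker B C))"
  then have ij: "i < dim_row A * dim_row B * dim_row C" "j < dim_col A * dim_col B * dim_col C"
    by (auto simp: kronecker_def mult.assoc)
  have 1: "k div n div m = k div (m * n)" for k m n :: nat
    by (metis div_mult2_eq mult.commute)
  have 2: "k div n mod m = k mod (m * n) div n" for k m n :: nat
  proof (cases "n = 0")
    case False
    have "k mod (n * m) = n * (k div n mod m) + k mod n" by (rule mod_mult2_eq)
    then show ?thesis using False by (simp add: mult.commute[of m n])
  qed simp
  have 3: "k mod (m * n) mod n = k mod n" for k m n :: nat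
    by (simp add: mod_mod_cancel)
  have i': "i < dim_row A * (dim_row B * dim_row C)" and j': "j < dim_col A * (dim_col B * dim_col C)"
    using ij by (simp_all only: mult.assoc)
  have "kronecker (kronecker A B) C $$ (i, j)
      = A $$ (i div dim_row C div dim_row B, j div dim_col C div dim_col B) *
        B $$ (i div dim_row C mod dim_row B, j div dim_col C mod dim_col B) *
        C $$ (i mod dim_row C, j mod dim_col C)"
    using ij div_less_prod[OF ij(1)] div_less_prod[OF ij(2)] by (simp add: kronecker_def)
  moreover have "kronecker A (kronecker B C) $$ (i, j)
      = A $$ (i div (dim_row B * dim_row C), j div (dim_col B * dim_col C)) *
        (B $$ (i mod (dim_row B * dim_row C) div dim_row C, j mod (dim_col B * dim_col C) div dim_col C) *
         C $$ (i mod (dim_row B * dim_row C) mod dim_row C, j mod (dim_col B * dim_col C) mod dim_col C))"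
    using i' j' mod_less_prod[OF i'] mod_less_prod[OF j'] by (simp add: kronecker_def)
  ultimately show "kronecker (kronecker A B) C $$ (i, j) = kronecker A (kronecker B C) $$ (i, j)"
    by (simp only: 1 2 3 mult.assoc)
qed (auto simp: kronecker_def mult.assoc)

lemma kronecker_one_left: "kronecker (1\<^sub>m 1) A = (A :: 'a::semiring_1 mat)"
  by (intro eq_matI) (auto simp: kronecker_def)

definition swap_mat :: "nat \<Rightarrow> nat \<Rightarrow> 'a::semiring_1 mat" where
  "swap_mat n m = mat (m * n) (n * m) (\<lambda>(i, j). if j = (i mod n) * m + i div n then 1 else 0)"

lemma swap_index:
  assumes "i < m * (n::nat)"
  shows "(i mod n) * m + i div n < n * m"
    and "(((i mod n) * m + i div n) mod m) * n + ((i mod n) * m + i div n) div m = i"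
    and "((i mod n) * m + i div n) div m = i mod n" "((i mod n) * m + i div n) mod m = i div n"
  using assms div_less_prod[OF assms] mod_less_prod[OF assms] by (auto intro: pair_less_prod)

lemma swap_mat_mult:
  fixes K :: "'a::semiring_1 mat"
  assumes "K \<in> carrier_mat (n * m) l" "i < m * n" "j < l"
  shows "(swap_mat n m * K) $$ (i, j) = K $$ ((i mod n) * m + i div n, j)"
proof -
  have "(swap_mat n m * K) $$ (i, j) = (\<Sum>k<n * m. swap_mat n m $$ (i, k) * K $$ (k, j))"
    using assms by (intro mult_mat_index) (auto simp: swap_mat_def)
  also have "\<dots> = (\<Sum>k<n * m. if k = (i mod n) * m + i div n then K $$ (k, j) else 0)"
    using assms by (intro sum.cong) (auto simp: swap_mat_def)
  finally show ?thesis using swap_index(1)[OF assms(2)] by simp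
qed

lemma mult_swap_mat:
  fixes K :: "'a::semiring_1 mat"
  assumes "K \<in> carrier_mat l (m * n)" "i < l" "j < n * m"
  shows "(K * swap_mat n m) $$ (i, j) = K $$ (i, (j mod m) * n + j div m)"
proof -
  have "(K * swap_mat n m) $$ (i, j) = (\<Sum>k<m * n. K $$ (i, k) * swap_mat n m $$ (k, j))"
    using assms by (intro mult_mat_index) (auto simp: swap_mat_def)
  also have "\<dots> = (\<Sum>k<m * n. if k = (j mod m) * n + j div m then K $$ (i, k) else 0)"
  proof (intro sum.cong refl)
    fix k assume "k \<in> {..<m * n}"
    then have "(j = (k mod n) * m + k div n) = (k = (j mod m) * n + j div m)"
      using swap_index(2)[of k m n] swap_index(2)[of j n m] assms by auto
    then show "K $$ (i, k) * swap_mat n m $$ (k, j)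
        = (if k = (j mod m) * n + j div m then K $$ (i, k) else 0)"
      using assms \<open>k \<in> {..<m * n}\<close> by (auto simp: swap_mat_def)
  qed
  finally show ?thesis using swap_index(1)[OF assms(3)] by simp
qed

lemma swap_mat_carrier: "swap_mat n m \<in> carrier_mat (m * n) (n * m)"
  by (simp add: swap_mat_def)

lemma swap_mat_inverse: "swap_mat m n * swap_mat n m = (1\<^sub>m (n * m) :: 'a::semiring_1 mat)"
proof (rule eq_matI)
  fix i j assume "i < dim_row (1\<^sub>m (n * m) :: 'a mat)" "j < dim_col (1\<^sub>m (n * m) :: 'a mat)"
  then have ij: "i < n * m" "j < n * m" by auto
  show "(swap_mat m n * swap_mat n m) $$ (i, j) = (1\<^sub>m (n * m) :: 'a mat) $$ (i, j)"
    using ij swap_index[OF ij(1)]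
    by (subst swap_mat_mult[OF swap_mat_carrier]) (auto simp: swap_mat_def)
qed (auto simp: swap_mat_def)

lemma swap_mat_kronecker:
  fixes A :: "'a::comm_semiring_1 mat"
  assumes A: "A \<in> carrier_mat n n" and B: "B \<in> carrier_mat m m"
  shows "swap_mat n m * kronecker A B = kronecker B A * swap_mat n m"
proof (rule eq_matI)
  fix i j assume "i < dim_row (kronecker B A * swap_mat n m)" "j < dim_col (kronecker B A * swap_mat n m)"
  then have ij: "i < m * n" "j < n * m" using A B by (auto simp: kronecker_def swap_mat_def)
  have "(swap_mat n m * kronecker A B) $$ (i, j) = kronecker A B $$ ((i mod n) * m + i div n, j)"
    using A B ij by (intro swap_mat_mult) auto
  also have "\<dots> = A $$ (i mod n, j div m) * B $$ (i div n, j mod m)"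
    using kronecker_index[OF A B swap_index(1)[OF ij(1)] ij(2)] swap_index[OF ij(1)] by simp
  also have "\<dots> = kronecker B A $$ (i, (j mod m) * n + j div m)"
    using kronecker_index[OF B A ij(1) swap_index(1)[OF ij(2)]] swap_index[OF ij(2)]
    by (simp add: mult.commute)
  also have "\<dots> = (kronecker B A * swap_mat n m) $$ (i, j)"
    using A B ij by (intro mult_swap_mat[symmetric]) auto
  finally show "(swap_mat n m * kronecker A B) $$ (i, j) = (kronecker B A * swap_mat n m) $$ (i, j)" .
qed (use A B in \<open>auto simp: kronecker_def swap_mat_def\<close>)

definition rep_tensor :: "'a::finite_field GL2_rep \<Rightarrow> 'a GL2_rep \<Rightarrow> 'a GL2_rep" where
  "rep_tensor V W = mk_rep (rdim V * rdim W) (\<lambda>A. kronecker (ract V A) (ract W A))"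

lemma rep_tensor:
  "rdim (rep_tensor V W) = rdim V * rdim W"
  "ract (rep_tensor V W) = (\<lambda>A. kronecker (ract V A) (ract W A))"
proof -
  have *: "(\<lambda>A. kronecker (ract V A) (ract W A)) \<in> hom (GL 2) (GL (rdim V * rdim W))"
  proof (rule GL_homI)
    fix A B :: "'a mat" assume AB: "A \<in> carrier (GL 2)" "B \<in> carrier (GL 2)"
    show "kronecker (ract V (A * B)) (ract W (A * B))
        = kronecker (ract V A) (ract W A) * kronecker (ract V B) (ract W B)"
      unfolding ract_mult[OF AB] using ract_carrier AB by (intro kronecker_mult[symmetric])
  qed (auto simp: ract_carrier ract_one kronecker_one)
  show "rdim (rep_tensor V W) = rdim V * rdim W"
    "ract (rep_tensor V W) = (\<lambda>A. kronecker (ract V A) (ract W A))"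
    unfolding rep_tensor_def by (simp_all add: mk_rep[OF *])
qed

lemma rep_tensor_assoc: "rep_tensor (rep_tensor U V) W = rep_tensor U (rep_tensor V W)"
  by (rule rep_eqI) (simp_all add: rep_tensor kronecker_assoc)

definition triv_rep :: "'a::finite_field GL2_rep" where
  "triv_rep = mk_rep 1 (\<lambda>_. 1\<^sub>m 1)"

lemma triv_rep: "rdim (triv_rep :: 'a::finite_field GL2_rep) = 1" "ract (triv_rep :: 'a GL2_rep) = (\<lambda>_. 1\<^sub>m 1)"
proof -
  have *: "(\<lambda>_ :: 'a mat. 1\<^sub>m 1) \<in> hom (GL 2) (GL 1 :: 'a mat monoid)" by (rule GL_homI) auto
  show "rdim (triv_rep :: 'a GL2_rep) = 1" "ract triv_rep = (\<lambda>_. 1\<^sub>m 1 :: 'a mat)"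
    unfolding triv_rep_def by (simp_all only: mk_rep[OF *])
qed

lemma rep_tensor_triv: "rep_tensor triv_rep V = V"
  by (rule rep_eqI) (auto simp only: rep_tensor triv_rep kronecker_one_left mult_1_left)

definition zero_rep :: "'a::finite_field GL2_rep" where
  "zero_rep = mk_rep 0 (\<lambda>_. 1\<^sub>m 0)"

lemma zero_rep: "rdim (zero_rep :: 'a::finite_field GL2_rep) = 0" "ract (zero_rep :: 'a GL2_rep) = (\<lambda>_. 1\<^sub>m 0)"
proof -
  have *: "(\<lambda>_ :: 'a mat. 1\<^sub>m 0) \<in> hom (GL 2) (GL 0 :: 'a mat monoid)" by (rule GL_homI) auto
  show "rdim (zero_rep :: 'a GL2_rep) = 0" "ract zero_rep = (\<lambda>_. 1\<^sub>m 0 :: 'a mat)"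
    unfolding zero_rep_def by (simp_all only: mk_rep[OF *])
qed

lemma short_exact_tensor:
  assumes "short_exact U V W"
  shows "short_exact (rep_tensor U X) (rep_tensor V X) (rep_tensor W X)"
proof -
  obtain P Q P' Q' where i: "intertwiner U V P" "intertwiner V W Q"
    and s: "mat_split (rdim U) (rdim V) (rdim W) P Q P' Q'"
    using assms by (auto simp: short_exact_split)
  let ?I = "1\<^sub>m (rdim X) :: 'a mat"
  have I: "?I \<in> carrier_mat (rdim X) (rdim X)" by simp
  have int: "intertwiner (rep_tensor Y X) (rep_tensor Z X) (kronecker T ?I)"
    if "intertwiner Y Z T" for Y Z T
    unfolding intertwiner_def rep_tensor
  proof (intro conjI ballI)
    have T: "T \<in> carrier_mat (rdim Z) (rdim Y)" using that by (simp add: intertwiner_def)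
    then show "kronecker T ?I \<in> carrier_mat (rdim Z * rdim X) (rdim Y * rdim X)" by simp
    fix A :: "'a mat" assume A: "A \<in> carrier (GL 2)"
    note c = ract_carrier[OF A]
    show "kronecker T ?I * kronecker (ract Y A) (ract X A) = kronecker (ract Z A) (ract X A) * kronecker T ?I"
      using that A c[of X] unfolding kronecker_mult[OF T c I c] kronecker_mult[OF c T c I]
      by (simp add: intertwiner_def)
  qed
  have c: "P \<in> carrier_mat (rdim V) (rdim U)" "Q \<in> carrier_mat (rdim W) (rdim V)"
    "P' \<in> carrier_mat (rdim U) (rdim V)" "Q' \<in> carrier_mat (rdim V) (rdim W)"
    and e: "P' * P = 1\<^sub>m (rdim U)" "Q * Q' = 1\<^sub>m (rdim W)" "P * P' + Q' * Q = 1\<^sub>m (rdim V)"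
    "Q * P = 0\<^sub>m (rdim W) (rdim U)" "P' * Q' = 0\<^sub>m (rdim U) (rdim W)"
    using s by (auto simp: mat_split_def)
  have sum: "kronecker (P * P') ?I + kronecker (Q' * Q) ?I = 1\<^sub>m (rdim V * rdim X)"
    using c by (subst kronecker_add_left[symmetric]) (auto simp: e kronecker_one)
  have "mat_split (rdim U * rdim X) (rdim V * rdim X) (rdim W * rdim X)
      (kronecker P ?I) (kronecker Q ?I) (kronecker P' ?I) (kronecker Q' ?I)"
    unfolding mat_split_def using c sum
    by (simp add: kronecker_mult[OF c(3) c(1) I I] kronecker_mult[OF c(2) c(4) I I]
        kronecker_mult[OF c(1) c(3) I I] kronecker_mult[OF c(4) c(2) I I]
        kronecker_mult[OF c(2) c(1) I I] kronecker_mult[OF c(3) c(4) I I] e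
        kronecker_one kronecker_zero_left)
  then show ?thesis
    unfolding short_exact_split using int[OF i(1)] int[OF i(2)] by (auto simp: rep_tensor(1))
qed

definition rep_iso :: "'a::finite_field GL2_rep \<Rightarrow> 'a GL2_rep \<Rightarrow> bool" where
  "rep_iso V W \<longleftrightarrow> (\<exists>S T. intertwiner V W S \<and> T \<in> carrier_mat (rdim V) (rdim W) \<and>
     T * S = 1\<^sub>m (rdim V) \<and> S * T = 1\<^sub>m (rdim W))"

lemma rep_iso_short_exact:
  assumes "rep_iso V W"
  shows "short_exact V W zero_rep"
proof -
  obtain S T where S: "intertwiner V W S" and T: "T \<in> carrier_mat (rdim V) (rdim W)"
    "T * S = 1\<^sub>m (rdim V)" "S * T = 1\<^sub>m (rdim W)"
    using assms by (auto simp: rep_iso_def)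
  have Sc: "S \<in> carrier_mat (rdim W) (rdim V)" using S by (simp add: intertwiner_def)
  have "intertwiner W zero_rep (0\<^sub>m 0 (rdim W))"
    by (auto simp: intertwiner_def zero_rep intro!: eq_matI dest!: ract_carrier[of _ W])
  moreover have "mat_split (rdim V) (rdim W) (rdim zero_rep) S (0\<^sub>m 0 (rdim W)) T (0\<^sub>m (rdim W) 0)"
    using T Sc by (auto simp: mat_split_def zero_rep intro!: eq_matI)
  ultimately show ?thesis unfolding short_exact_split using S by blast
qed

lemma rep_tensor_commute: "rep_iso (rep_tensor V W) (rep_tensor W V)"
  unfolding rep_iso_def
proof (intro exI conjI)
  show "intertwiner (rep_tensor V W) (rep_tensor W V) (swap_mat (rdim V) (rdim W))"
    by (simp add: intertwiner_def rep_tensor swap_mat_carrier swap_mat_kronecker[OF ract_carrier ract_carrier])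
  show "swap_mat (rdim W) (rdim V) \<in> carrier_mat (rdim (rep_tensor V W)) (rdim (rep_tensor W V))"
    by (simp add: rep_tensor swap_mat_carrier)
qed (simp_all add: rep_tensor swap_mat_inverse)

section \<open>The Grothendieck ring\<close>

text \<open>
  \<open>K\<^sub>0(G)\<close> is the free abelian group on all representations modulo the subgroup generated by
  \<open>[V] - [U] - [W]\<close> for all short exact sequences \<open>0 \<rightarrow> U \<rightarrow> V \<rightarrow> W \<rightarrow> 0\<close>.
\<close>

inductive_set K0_relations :: "('a::finite_field GL2_rep \<Rightarrow>\<^sub>0 int) set" where
  K0_exact: "short_exact U V W \<Longrightarrow> frag_of V - frag_of U - frag_of W \<in> K0_relations"
| K0_zero: "0 \<in> K0_relations"
| K0_diff: "x \<in> K0_relations \<Longrightarrow> y \<in> K0_relations \<Longrightarrow> x - y \<in> K0_relations"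

lemma K0_minus: "x \<in> K0_relations \<Longrightarrow> - x \<in> K0_relations"
  using K0_diff[OF K0_zero] by fastforce

lemma K0_add: "x \<in> K0_relations \<Longrightarrow> y \<in> K0_relations \<Longrightarrow> x + y \<in> K0_relations"
  using K0_diff[OF _ K0_minus, of x y] by simp

lemma K0_relations_equivp: "equivp (\<lambda>x y. x - y \<in> K0_relations)"
proof (rule equivpI)
  show "reflp (\<lambda>x y. x - y \<in> K0_relations)" by (auto intro!: reflpI K0_zero)
  show "symp (\<lambda>x y. x - y \<in> K0_relations)" by (rule sympI) (use K0_minus in fastforce)
  show "transp (\<lambda>x y. x - y \<in> K0_relations)" by (rule transpI) (use K0_add in fastforce)
qed

quotient_type (overloaded) 'a K0 =
  "'a::finite_field GL2_rep \<Rightarrow>\<^sub>0 int" / "\<lambda>x y. x - y \<in> K0_relations"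
  by (rule K0_relations_equivp)

lift_definition K0_class :: "'a::finite_field GL2_rep \<Rightarrow> 'a K0" is frag_of .

lemma frag_ind [case_names zero of_rep diff]:
  assumes "P 0" "\<And>V. P (frag_of V)" "\<And>x y. P x \<Longrightarrow> P y \<Longrightarrow> P (x - y)"
  shows "P x"
  using frag_induction[of x UNIV P] assms by auto

definition frag_tensor ::
    "('a::finite_field GL2_rep \<Rightarrow>\<^sub>0 int) \<Rightarrow> ('a GL2_rep \<Rightarrow>\<^sub>0 int) \<Rightarrow> ('a GL2_rep \<Rightarrow>\<^sub>0 int)" where
  "frag_tensor x y = frag_extend (\<lambda>V. frag_extend (\<lambda>W. frag_of (rep_tensor V W)) y) x"

lemma frag_tensor_diff_left: "frag_tensor (x - x') y = frag_tensor x y - frag_tensor x' y"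
  by (simp add: frag_tensor_def frag_extend_diff)

lemma frag_tensor_zero [simp]: "frag_tensor 0 y = 0" "frag_tensor x 0 = 0"
  by (simp_all add: frag_tensor_def frag_extend_eq_0)

lemma frag_tensor_of [simp]: "frag_tensor (frag_of V) (frag_of W) = frag_of (rep_tensor V W)"
  by (simp add: frag_tensor_def)

lemma frag_tensor_diff_right: "frag_tensor x (y - y') = frag_tensor x y - frag_tensor x y'"
proof (induction x rule: frag_ind)
  case (of_rep V)
  show ?case by (simp add: frag_tensor_def frag_extend_diff)
qed (simp_all add: frag_tensor_diff_left)

lemma frag_tensor_add_left: "frag_tensor (x + x') y = frag_tensor x y + frag_tensor x' y"
  by (simp add: frag_tensor_def frag_extend_add)

lemma frag_tensor_assoc: "frag_tensor (frag_tensor x y) z = frag_tensor x (frag_tensor y z)"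
proof (induction x rule: frag_ind)
  case (of_rep U)
  show ?case
  proof (induction y rule: frag_ind)
    case (of_rep V)
    show ?case
      by (induction z rule: frag_ind) (simp_all add: frag_tensor_diff_right rep_tensor_assoc)
  qed (simp_all add: frag_tensor_diff_left frag_tensor_diff_right)
qed (simp_all add: frag_tensor_diff_left)

lemma frag_tensor_triv: "frag_tensor (frag_of triv_rep) x = x"
  by (induction x rule: frag_ind) (simp_all add: frag_tensor_diff_right rep_tensor_triv)

lemma K0_zero_rep: "frag_of zero_rep \<in> K0_relations"
proof -
  have "rep_iso zero_rep (zero_rep :: 'a GL2_rep)"
    unfolding rep_iso_def intertwiner_def zero_rep by (auto intro!: exI[of _ "1\<^sub>m 0"])
  then have "frag_of zero_rep - frag_of zero_rep - frag_of (zero_rep :: 'a GL2_rep) \<in> K0_relations"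
    by (intro K0_exact rep_iso_short_exact)
  then show ?thesis using K0_minus by fastforce
qed

lemma rep_iso_relation:
  assumes "rep_iso V W"
  shows "frag_of W - frag_of V \<in> K0_relations"
  using K0_add[OF K0_exact[OF rep_iso_short_exact[OF assms]] K0_zero_rep] by simp

lemma rep_iso_class: "rep_iso V W \<Longrightarrow> K0_class V = K0_class W"
  by transfer (use K0_minus[OF rep_iso_relation] in fastforce)

lemma short_exact_class: "short_exact U V W \<Longrightarrow> frag_of V - (frag_of U + frag_of W) \<in> K0_relations"
  using K0_exact by (simp add: diff_diff_eq)

lemma frag_tensor_commute: "frag_tensor x y - frag_tensor y x \<in> K0_relations"
proof (induction x rule: frag_ind)
  case (of_rep V)
  show ?case
  proof (induction y rule: frag_ind)
    case (of_rep W)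
    show ?case by (simp add: rep_iso_relation rep_tensor_commute)
  next
    case (diff x y)
    then show ?case using K0_diff[OF diff]
      by (simp add: frag_tensor_diff_left frag_tensor_diff_right algebra_simps)
  qed (simp add: K0_zero)
next
  case (diff x x')
  then show ?case using K0_diff[OF diff]
    by (simp add: frag_tensor_diff_left frag_tensor_diff_right algebra_simps)
qed (simp add: K0_zero)

lemma frag_tensor_relation_left:
  assumes "x \<in> K0_relations"
  shows "frag_tensor x y \<in> K0_relations"
  using assms
proof (induction x)
  case (K0_exact U V W)
  show ?case
  proof (induction y rule: frag_ind)
    case (of_rep X)
    show ?case
      using K0_relations.K0_exact[OF short_exact_tensor[OF K0_exact, of X]]
      by (simp add: frag_tensor_diff_left)
  next
    case (diff x y)
    then show ?case using K0_relations.K0_diff by (simp add: frag_tensor_diff_right)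
  qed (simp add: K0_zero)
next
  case (K0_diff x y)
  then show ?case using K0_relations.K0_diff by (simp add: frag_tensor_diff_left)
qed (simp add: K0_zero)

lemma frag_tensor_relation_right:
  assumes "y \<in> K0_relations"
  shows "frag_tensor x y \<in> K0_relations"
  using K0_add[OF frag_tensor_commute[of x y] frag_tensor_relation_left[OF assms, of x]] by simp

text \<open>Dimension is additive; it separates \<open>0\<close> from \<open>1\<close> in the Grothendieck ring.\<close>

lemma card_carrier_vec: "card (carrier_vec n :: 'a::finite vec set) = CARD('a) ^ n"
proof -
  have "carrier_vec n = vec_of_list ` {xs :: 'a list. set xs \<subseteq> UNIV \<and> length xs = n}"
  proof (intro equalityI subsetI)
    fix v :: "'a vec" assume "v \<in> carrier_vec n"
    then show "v \<in> vec_of_list ` {xs :: 'a list. set xs \<subseteq> UNIV \<and> length xs = n}"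
      by (intro image_eqI[of _ _ "list_of_vec v"]) (auto simp: vec_list)
  qed (auto intro!: carrier_vecI)
  moreover have "inj_on vec_of_list {xs :: 'a list. set xs \<subseteq> UNIV \<and> length xs = n}"
    by (rule inj_on_inverseI[of _ list_of_vec]) (simp add: list_vec)
  ultimately have "card (carrier_vec n :: 'a vec set) = card {xs :: 'a list. set xs \<subseteq> UNIV \<and> length xs = n}"
    by (simp only: card_image)
  then show ?thesis by (simp only: card_lists_length_eq[OF finite_class.finite_UNIV])
qed

lemma mat_split_dim:
  fixes P Q :: "'a::finite_field mat"
  assumes "mat_split l n m P Q P' Q'"
  shows "n = l + m"
proof -
  have c: "P \<in> carrier_mat n l" "Q \<in> carrier_mat m n" "P' \<in> carrier_mat l n" "Q' \<in> carrier_mat n m"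
    and e: "P' * P = 1\<^sub>m l" "Q * Q' = 1\<^sub>m m" "P * P' + Q' * Q = 1\<^sub>m n"
      "Q * P = 0\<^sub>m m l" "P' * Q' = 0\<^sub>m l m"
    using assms by (auto simp: mat_split_def)
  have "bij_betw (\<lambda>v. (P' *\<^sub>v v, Q *\<^sub>v v)) (carrier_vec n) (carrier_vec l \<times> carrier_vec m)"
  proof (rule bij_betw_byWitness[of _ "\<lambda>(x, y). P *\<^sub>v x + Q' *\<^sub>v y"])
    show "\<forall>v\<in>carrier_vec n. (case (P' *\<^sub>v v, Q *\<^sub>v v) of (x, y) \<Rightarrow> P *\<^sub>v x + Q' *\<^sub>v y) = v"
    proof
      fix v :: "'a vec" assume v: "v \<in> carrier_vec n"
      have "P *\<^sub>v (P' *\<^sub>v v) + Q' *\<^sub>v (Q *\<^sub>v v) = (P * P') *\<^sub>v v + (Q' * Q) *\<^sub>v v"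
        using c v by (simp add: assoc_mult_mat_vec)
      also have "\<dots> = (P * P' + Q' * Q) *\<^sub>v v"
        using c v by (intro add_mult_distrib_mat_vec[symmetric]) auto
      finally show "(case (P' *\<^sub>v v, Q *\<^sub>v v) of (x, y) \<Rightarrow> P *\<^sub>v x + Q' *\<^sub>v y) = v"
        using v by (simp add: e)
    qed
    show "\<forall>z\<in>carrier_vec l \<times> carrier_vec m.
        (P' *\<^sub>v (case z of (x, y) \<Rightarrow> P *\<^sub>v x + Q' *\<^sub>v y), Q *\<^sub>v (case z of (x, y) \<Rightarrow> P *\<^sub>v x + Q' *\<^sub>v y)) = z"
    proof clarify
      fix x y :: "'a vec" assume xy: "x \<in> carrier_vec l" "y \<in> carrier_vec m"
      have xy': "P *\<^sub>v x \<in> carrier_vec n" "Q' *\<^sub>v y \<in> carrier_vec n"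
        using c xy by (auto intro: mult_mat_vec_carrier)
      have "P' *\<^sub>v (P *\<^sub>v x + Q' *\<^sub>v y) = P' *\<^sub>v (P *\<^sub>v x) + P' *\<^sub>v (Q' *\<^sub>v y)"
        using c xy' by (intro mult_add_distrib_mat_vec) auto
      also have "\<dots> = x"
        using xy by (simp add: assoc_mult_mat_vec[OF c(3) c(1), symmetric]
            assoc_mult_mat_vec[OF c(3) c(4), symmetric] e zero_mult_mat_vec)
      finally have 1: "P' *\<^sub>v (P *\<^sub>v x + Q' *\<^sub>v y) = x" .
      have "Q *\<^sub>v (P *\<^sub>v x + Q' *\<^sub>v y) = Q *\<^sub>v (P *\<^sub>v x) + Q *\<^sub>v (Q' *\<^sub>v y)"
        using c xy' by (intro mult_add_distrib_mat_vec) auto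
      also have "\<dots> = y"
        using xy by (simp add: assoc_mult_mat_vec[OF c(2) c(1), symmetric]
            assoc_mult_mat_vec[OF c(2) c(4), symmetric] e zero_mult_mat_vec)
      finally show "P' *\<^sub>v (P *\<^sub>v x + Q' *\<^sub>v y) = x \<and> Q *\<^sub>v (P *\<^sub>v x + Q' *\<^sub>v y) = y"
        using 1 by simp
    qed
  qed (use c in auto)
  then have "CARD('a) ^ n = CARD('a) ^ (l + m)"
    by (simp add: bij_betw_same_card card_carrier_vec[symmetric] power_add)
       (metis bij_betw_same_card card_cartesian_product)
  moreover have "card {0, 1 :: 'a} \<le> CARD('a)" by (intro card_mono) auto
  ultimately show ?thesis by (simp add: power_inject_exp)
qed

definition frag_dim :: "('a::finite_field GL2_rep \<Rightarrow>\<^sub>0 int) \<Rightarrow> (unit \<Rightarrow>\<^sub>0 int)" where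
  "frag_dim = frag_extend (\<lambda>V. frag_cmul (int (rdim V)) (frag_of ()))"

lemma frag_dim_relation: "x \<in> K0_relations \<Longrightarrow> frag_dim x = 0"
proof (induction rule: K0_relations.induct)
  case (K0_exact U V W)
  then have "rdim V = rdim U + rdim W"
    by (auto simp: short_exact_split dest: mat_split_dim)
  then show ?case by (simp add: frag_dim_def frag_extend_diff frag_cmul_distrib)
qed (simp_all add: frag_dim_def frag_extend_diff)

instantiation K0 :: (finite_field) comm_ring_1
begin

lift_definition zero_K0 :: "'a K0" is 0 .
lift_definition one_K0 :: "'a K0" is "frag_of triv_rep" .
lift_definition plus_K0 :: "'a K0 \<Rightarrow> 'a K0 \<Rightarrow> 'a K0" is "(+)"
proof -
  fix x x' y y' :: "'a GL2_rep \<Rightarrow>\<^sub>0 int"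
  assume "x - x' \<in> K0_relations" "y - y' \<in> K0_relations"
  from K0_add[OF this] show "(x + y) - (x' + y') \<in> K0_relations" by (simp add: algebra_simps)
qed
lift_definition uminus_K0 :: "'a K0 \<Rightarrow> 'a K0" is uminus
proof -
  fix x x' :: "'a GL2_rep \<Rightarrow>\<^sub>0 int"
  assume "x - x' \<in> K0_relations"
  from K0_minus[OF this] show "- x - - x' \<in> K0_relations" by simp
qed
lift_definition minus_K0 :: "'a K0 \<Rightarrow> 'a K0 \<Rightarrow> 'a K0" is "(-)"
proof -
  fix x x' y y' :: "'a GL2_rep \<Rightarrow>\<^sub>0 int"
  assume "x - x' \<in> K0_relations" "y - y' \<in> K0_relations"
  from K0_diff[OF this] show "(x - y) - (x' - y') \<in> K0_relations" by (simp add: algebra_simps)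
qed
lift_definition times_K0 :: "'a K0 \<Rightarrow> 'a K0 \<Rightarrow> 'a K0" is frag_tensor
proof -
  fix x x' y y' :: "'a GL2_rep \<Rightarrow>\<^sub>0 int"
  assume "x - x' \<in> K0_relations" "y - y' \<in> K0_relations"
  then have "frag_tensor (x - x') y + frag_tensor x' (y - y') \<in> K0_relations"
    by (intro K0_add frag_tensor_relation_left frag_tensor_relation_right)
  then show "frag_tensor x y - frag_tensor x' y' \<in> K0_relations"
    by (simp add: frag_tensor_diff_left frag_tensor_diff_right)
qed

instance
proof
  fix a b c :: "'a K0"
  show "a * b * c = a * (b * c)" by transfer (simp add: frag_tensor_assoc K0_zero)
  show "a * b = b * a" by transfer (rule frag_tensor_commute)
  show "1 * a = a" by transfer (simp add: frag_tensor_triv K0_zero)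
  show "a + b + c = a + (b + c)" by transfer (simp add: add.assoc K0_zero)
  show "a + b = b + a" by transfer (simp add: add.commute K0_zero)
  show "0 + a = a" by transfer (simp add: K0_zero)
  show "- a + a = 0" by transfer (simp add: K0_zero)
  show "a - b = a + - b" by transfer (simp add: K0_zero)
  show "(a + b) * c = a * c + b * c" by transfer (simp add: frag_tensor_add_left K0_zero)
  show "(0 :: 'a K0) \<noteq> 1"
  proof (transfer, rule notI)
    assume "0 - frag_of (triv_rep :: 'a GL2_rep) \<in> K0_relations"
    from frag_dim_relation[OF this] show False
      by (simp add: frag_dim_def frag_extend_minus triv_rep(1))
  qed
qed

end

lemma K0_class_tensor: "K0_class (rep_tensor V W) = K0_class V * K0_class W"
  by transfer (simp add: K0_zero)

lemma K0_class_triv: "K0_class triv_rep = 1"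
  by transfer (simp add: K0_zero)

lemma K0_class_exact: "short_exact U V W \<Longrightarrow> K0_class V = K0_class U + K0_class W"
  by transfer (rule short_exact_class)

section \<open>Frobenius twists\<close>

definition frob :: "'a::finite_field \<Rightarrow> 'a" where
  "frob x = x ^ CHAR('a)"

definition frob_power :: "int \<Rightarrow> 'a::finite_field \<Rightarrow> 'a" where
  "frob_power n = (if 0 \<le> n then frob ^^ nat n else inv_into UNIV frob ^^ nat (- n))"

lemma CHAR_eq_of_CARD:
  assumes "prime p" "CARD('a::finite_field) = p ^ g"
  shows "CHAR('a) = p"
proof -
  have "(\<Sum>x\<in>UNIV. x + 1 :: 'a) = (\<Sum>x\<in>UNIV. x)"
    by (rule sum.reindex_bij_witness[of _ "\<lambda>x. x - 1" "\<lambda>x. x + 1"]) auto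
  then have "of_nat CARD('a) = (0 :: 'a)" by (simp add: sum.distrib)
  then have "CHAR('a) dvd p ^ g" using assms(2) by (metis of_nat_eq_0_iff_char_dvd)
  then have "CHAR('a) dvd p" using prime_dvd_power[OF CHAR_prime] by blast
  then show ?thesis using assms(1) primes_dvd_imp_eq[OF CHAR_prime] by blast
qed

lemma frob_hom: "comm_ring_hom (frob :: 'a::finite_field \<Rightarrow> 'a)"
  by unfold_locales (auto simp: frob_def freshmans_dream power_mult_distrib)

lemma field_hom_eq_0:
  fixes h :: "'a::field \<Rightarrow> 'a"
  assumes "comm_ring_hom h" "h x = 0"
  shows "x = 0"
proof (rule ccontr)
  interpret comm_ring_hom h by fact
  assume "x \<noteq> 0"
  then have "h (x * inverse x) = 1" by simp
  then show False using assms(2) by (simp only: hom_mult) simp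
qed

lemma frob_bij: "bij (frob :: 'a::finite_field \<Rightarrow> 'a)"
proof -
  interpret comm_ring_hom "frob :: 'a \<Rightarrow> 'a" by (rule frob_hom)
  have "inj (frob :: 'a \<Rightarrow> 'a)"
  proof (rule injI)
    fix x y :: 'a assume "frob x = frob y"
    then have "frob (x - y) = 0" by (simp add: hom_minus)
    then show "x = y" using field_hom_eq_0[OF frob_hom] by fastforce
  qed
  then show ?thesis using finite_UNIV_inj_surj[OF finite_class.finite_UNIV] unfolding bij_def by blast
qed

lemma inv_frob_hom: "comm_ring_hom (inv_into UNIV frob :: 'a::finite_field \<Rightarrow> 'a)"
proof -
  interpret comm_ring_hom "frob :: 'a \<Rightarrow> 'a" by (rule frob_hom)
  let ?i = "inv_into UNIV frob :: 'a \<Rightarrow> 'a"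
  have s: "frob (?i x) = x" for x by (rule f_inv_into_f) (use bij_is_surj[OF frob_bij] in auto)
  have inv: "?i (frob x) = x" for x by (rule inv_into_f_f) (use bij_is_inj[OF frob_bij] in auto)
  show ?thesis
  proof
    show "?i (x + y) = ?i x + ?i y" for x y using inv[of "?i x + ?i y"] by (simp add: hom_add s)
    show "?i (x * y) = ?i x * ?i y" for x y using inv[of "?i x * ?i y"] by (simp add: hom_mult s)
    show "?i 1 = 1" using inv[of 1] by simp
    show "?i 0 = 0" using inv[of 0] by simp
  qed
qed

lemma funpow_hom:
  fixes h :: "'a::comm_ring_1 \<Rightarrow> 'a"
  assumes "comm_ring_hom h"
  shows "comm_ring_hom (h ^^ n)"
proof -
  interpret comm_ring_hom h by fact
  show ?thesis
  proof
    fix x y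
    show "(h ^^ n) (x + y) = (h ^^ n) x + (h ^^ n) y" by (induction n) (simp_all add: hom_add)
    show "(h ^^ n) (x * y) = (h ^^ n) x * (h ^^ n) y" by (induction n) (simp_all add: hom_mult)
    show "(h ^^ n) 0 = 0" "(h ^^ n) 1 = 1" by (induction n) simp_all
  qed
qed

lemma frob_power_hom: "comm_ring_hom (frob_power n :: 'a::finite_field \<Rightarrow> 'a)"
  unfolding frob_power_def using funpow_hom[OF frob_hom] funpow_hom[OF inv_frob_hom] by auto

lemma frob_power_GL:
  assumes "A \<in> carrier (GL n)"
  shows "map_mat (frob_power k) A \<in> carrier (GL n)"
proof -
  interpret comm_ring_hom "frob_power k :: 'a \<Rightarrow> 'a" by (rule frob_power_hom)
  show ?thesis
    using assms field_hom_eq_0[OF frob_power_hom[of k], of "det A"] by (auto simp: carrier_GL_det)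
qed

definition rep_twist :: "int \<Rightarrow> 'a::finite_field GL2_rep \<Rightarrow> 'a GL2_rep" where
  "rep_twist n V = mk_rep (rdim V) (\<lambda>A. ract V (map_mat (frob_power n) A))"

lemma rep_twist:
  fixes V :: "'a::finite_field GL2_rep"
  shows "rdim (rep_twist n V) = rdim V"
    and "ract (rep_twist n V) = (\<lambda>A. ract V (map_mat (frob_power n) A))"
proof -
  interpret comm_ring_hom "frob_power n :: 'a \<Rightarrow> 'a" by (rule frob_power_hom)
  have *: "(\<lambda>A. ract V (map_mat (frob_power n) A)) \<in> hom (GL 2) (GL (rdim V))"
  proof (rule GL_homI)
    fix A B :: "'a mat" assume AB: "A \<in> carrier (GL 2)" "B \<in> carrier (GL 2)"
    then have "map_mat (frob_power n) (A * B) = map_mat (frob_power n) A * map_mat (frob_power n) B"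
      by (intro mat_hom_mult[of _ 2 2 _ 2]) (auto simp: carrier_GL)
    then show "ract V (map_mat (frob_power n) (A * B))
        = ract V (map_mat (frob_power n) A) * ract V (map_mat (frob_power n) B)"
      using AB by (simp add: ract_mult frob_power_GL)
  qed (simp_all add: ract_carrier frob_power_GL mat_hom_one ract_one)
  show "rdim (rep_twist n V) = rdim V"
    "ract (rep_twist n V) = (\<lambda>A. ract V (map_mat (frob_power n) A))"
    unfolding rep_twist_def by (simp_all add: mk_rep[OF *])
qed

lemma short_exact_twist:
  assumes "short_exact U V W"
  shows "short_exact (rep_twist n U) (rep_twist n V) (rep_twist n W)"
proof -
  have "intertwiner (rep_twist n X) (rep_twist n Y) T" if "intertwiner X Y T" for X Y T
    using that by (auto simp: intertwiner_def rep_twist frob_power_GL)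
  then show ?thesis using assms unfolding short_exact_split rep_twist(1) by blast
qed

lift_definition K0_twist :: "int \<Rightarrow> 'a::finite_field K0 \<Rightarrow> 'a K0" is
  "\<lambda>n. frag_extend (\<lambda>V. frag_of (rep_twist n V))"
proof -
  fix n and x y :: "'a GL2_rep \<Rightarrow>\<^sub>0 int"
  let ?f = "frag_extend (\<lambda>V. frag_of (rep_twist n V)) :: ('a GL2_rep \<Rightarrow>\<^sub>0 int) \<Rightarrow> _"
  have "?f z \<in> K0_relations" if "z \<in> K0_relations" for z
    using that
  proof (induction z)
    case (K0_exact U V W)
    then show ?case
      using K0_relations.K0_exact[OF short_exact_twist] by (simp add: frag_extend_diff)
  next
    case (K0_diff x y)
    then show ?case using K0_relations.K0_diff by (simp add: frag_extend_diff)
  qed (simp add: K0_zero)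
  moreover assume "x - y \<in> K0_relations"
  ultimately show "?f x - ?f y \<in> K0_relations" by (metis frag_extend_diff)
qed

lemma K0_twist_class: "K0_twist n (K0_class V) = K0_class (rep_twist n V)"
  by transfer (simp add: K0_zero)

lemma K0_twist_hom: "comm_ring_hom (K0_twist n :: 'a::finite_field K0 \<Rightarrow> 'a K0)"
proof
  fix x y :: "'a K0"
  show "K0_twist n (x + y) = K0_twist n x + K0_twist n y"
    by transfer (simp add: frag_extend_add K0_zero)
  show "K0_twist n (x * y) = K0_twist n x * K0_twist n y"
  proof transfer
    fix n and x y :: "'a GL2_rep \<Rightarrow>\<^sub>0 int"
    let ?f = "frag_extend (\<lambda>V. frag_of (rep_twist n V)) :: ('a GL2_rep \<Rightarrow>\<^sub>0 int) \<Rightarrow> _"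
    have of: "rep_twist n (rep_tensor V W) = rep_tensor (rep_twist n V) (rep_twist n W)"
      for V W :: "'a GL2_rep"
      by (rule rep_eqI) (simp_all add: rep_twist rep_tensor)
    have "?f (frag_tensor x y) = frag_tensor (?f x) (?f y)"
    proof (induction x rule: frag_ind)
      case (of_rep V)
      show ?case
        by (induction y rule: frag_ind) (simp_all add: of frag_tensor_diff_right frag_extend_diff)
    qed (simp_all add: frag_tensor_diff_left frag_extend_diff)
    then show "?f (frag_tensor x y) - frag_tensor (?f x) (?f y) \<in> K0_relations"
      by (simp add: K0_zero)
  qed
  have "rep_twist n triv_rep = (triv_rep :: 'a GL2_rep)"
    by (rule rep_eqI) (simp_all only: rep_twist triv_rep)
  then show "K0_twist n 1 = (1 :: 'a K0)" by (metis K0_class_triv K0_twist_class)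
  show "K0_twist n 0 = (0 :: 'a K0)" by transfer (simp add: K0_zero)
qed

section \<open>The determinant character\<close>

definition det_rep :: "'a::finite_field GL2_rep" where
  "det_rep = mk_rep 1 (\<lambda>A. mat 1 1 (\<lambda>_. det A))"

definition det_class :: "'a::finite_field K0" where
  "det_class = K0_class det_rep"

text \<open>
  Since \<open>e\<^sup>q\<^sup>-\<^sup>1 = 1\<close> for the class \<open>e\<close> of the determinant, integer exponents of \<open>e\<close> are read
  modulo \<open>q - 1\<close>.
\<close>

definition det_class_power :: "int \<Rightarrow> 'a::finite_field K0" where
  "det_class_power n = det_class ^ nat (n mod int (CARD('a) - 1))"

lemma det_power_rep:
  fixes m :: nat
  defines "\<rho> \<equiv> \<lambda>A :: 'a::finite_field mat. mat 1 1 (\<lambda>_. det A ^ m)"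
  shows "rdim (mk_rep 1 \<rho>) = 1" "ract (mk_rep 1 \<rho>) = \<rho>"
proof -
  have "\<rho> \<in> hom (GL 2) (GL 1)"
  proof (rule GL_homI)
    fix A B :: "'a mat" assume "A \<in> carrier (GL 2)" "B \<in> carrier (GL 2)"
    then have "det (A * B) = det A * det B" by (intro det_mult) (auto simp: carrier_GL)
    then show "\<rho> (A * B) = \<rho> A * \<rho> B"
      by (intro eq_matI) (auto simp: \<rho>_def scalar_prod_def power_mult_distrib)
  qed (auto simp: \<rho>_def)
  from mk_rep[OF this] show "rdim (mk_rep 1 \<rho>) = 1" "ract (mk_rep 1 \<rho>) = \<rho>" .
qed

lemma det_class_pow:
  "det_class ^ m = K0_class (mk_rep 1 (\<lambda>A :: 'a::finite_field mat. mat 1 1 (\<lambda>_. det A ^ m)))"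
proof (induction m)
  case 0
  have "mat 1 1 (\<lambda>_. 1) = (1\<^sub>m 1 :: 'a mat)" by (intro eq_matI) auto
  then show ?case by (simp add: K0_class_triv[symmetric] triv_rep_def)
next
  case (Suc m)
  have k: "kronecker (mat 1 1 (\<lambda>_. a)) (mat 1 1 (\<lambda>_. b)) = mat 1 1 (\<lambda>_. a * b)" for a b :: 'a
    by (intro eq_matI) (auto simp: kronecker_def)
  have d: "rdim (det_rep :: 'a GL2_rep) = 1" "ract det_rep = (\<lambda>A :: 'a mat. mat 1 1 (\<lambda>_. det A))"
    using det_power_rep[of 1, where ?'a = 'a] by (simp_all add: det_rep_def)
  have "rep_tensor det_rep (mk_rep 1 (\<lambda>A. mat 1 1 (\<lambda>_. det A ^ m)))
      = mk_rep 1 (\<lambda>A :: 'a mat. mat 1 1 (\<lambda>_. det A ^ Suc m))"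
    by (rule rep_eqI)
       (simp_all only: rep_tensor d det_power_rep[of m] det_power_rep[of "Suc m"] k power_Suc[symmetric] mult_1)
  then show ?case by (metis Suc K0_class_tensor det_class_def power_Suc)
qed

lemma rep_class_cong:
  assumes "rdim V = rdim W" "\<And>A. A \<in> carrier (GL 2) \<Longrightarrow> ract V A = ract W A"
  shows "K0_class V = K0_class W"
proof (rule rep_iso_class)
  have "intertwiner V W (1\<^sub>m (rdim V))"
    unfolding intertwiner_def using assms ract_carrier[of _ W]
    by (metis left_mult_one_mat one_carrier_mat right_mult_one_mat)
  then show "rep_iso V W"
    unfolding rep_iso_def using assms by (auto intro!: exI[of _ "1\<^sub>m (rdim W)"])
qed

lemma det_class_order: "det_class ^ (CARD('a) - 1) = (1 :: 'a::finite_field K0)"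
proof -
  have "x ^ (CARD('a) - 1) = 1" if "x \<noteq> 0" for x :: 'a
  proof -
    have "x * x ^ (CARD('a) - 1) = x ^ CARD('a)"
      by (metis Suc_pred' finite_UNIV_card_ge_0 finite_class.finite_UNIV power_Suc)
    then show ?thesis using that finite_field_power_card_eq_same[of x] by simp
  qed
  moreover have "mat 1 1 (\<lambda>_. 1) = (1\<^sub>m 1 :: 'a mat)" by (intro eq_matI) auto
  ultimately have "mat 1 1 (\<lambda>_. x ^ (CARD('a) - 1)) = (1\<^sub>m 1 :: 'a mat)" if "x \<noteq> 0" for x
    using that by simp
  then have "K0_class (mk_rep 1 (\<lambda>A :: 'a mat. mat 1 1 (\<lambda>_. det A ^ (CARD('a) - 1))))
      = K0_class triv_rep"
    by (intro rep_class_cong) (auto simp only: det_power_rep triv_rep carrier_GL_det)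
  then show ?thesis by (simp add: det_class_pow K0_class_triv)
qed

lemma det_class_power_nat: "det_class_power (int n) = (det_class ^ n :: 'a::finite_field K0)"
proof -
  let ?m = "CARD('a) - 1"
  have "det_class ^ n = (det_class ^ (?m * (n div ?m) + n mod ?m) :: 'a K0)" by simp
  also have "\<dots> = det_class ^ (n mod ?m)"
    unfolding power_add power_mult det_class_order by simp
  finally show ?thesis by (simp add: det_class_power_def nat_mod_as_int)
qed

lemma det_class_power_add:
  "det_class_power (m + n) = det_class_power m * (det_class_power n :: 'a::finite_field K0)"
proof -
  let ?m = "int (CARD('a) - 1)"
  have pos: "?m > 0"
  proof -
    have "card {0, 1 :: 'a} \<le> CARD('a)" by (intro card_mono) auto
    then show ?thesis by simp
  qed
  then have nn: "m mod ?m \<ge> 0" "n mod ?m \<ge> 0" by simp_all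
  have "det_class_power (m + n) = (det_class_power (int (nat (m mod ?m) + nat (n mod ?m))) :: 'a K0)"
    using nn by (simp add: det_class_power_def mod_add_eq del: of_nat_diff)
  then show ?thesis
    unfolding det_class_power_nat power_add by (simp add: det_class_power_def)
qed

section \<open>Symmetric powers\<close>

text \<open>
  \<open>Sym\<^sup>k\<close> of the standard representation has the basis \<open>e\<^sub>1\<^sup>k\<^sup>-\<^sup>j e\<^sub>2\<^sup>j\<close> for \<open>j = 0, \<dots>, k\<close>, and \<open>A\<close> maps
  this element to \<open>(A e\<^sub>1)\<^sup>k\<^sup>-\<^sup>j (A e\<^sub>2)\<^sup>j\<close>.  Homogeneous polynomials of degree \<open>k\<close> in \<open>e\<^sub>1, e\<^sub>2\<close> are
  dehomogenised by \<open>e\<^sub>1 = 1\<close>, so that \<open>[:a, c:]\<close> below stands for \<open>a e\<^sub>1 + c e\<^sub>2\<close>.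
\<close>

definition sym_mat :: "nat \<Rightarrow> 'a::finite_field mat \<Rightarrow> 'a mat" where
  "sym_mat k A = mat (k + 1) (k + 1) (\<lambda>(i, j).
     Polynomial.coeff ([:A $$ (0, 0), A $$ (1, 0):] ^ (k - j) * [:A $$ (0, 1), A $$ (1, 1):] ^ j) i)"

definition Sym_rep :: "nat \<Rightarrow> 'a::finite_field GL2_rep" where
  "Sym_rep k = mk_rep (k + 1) (sym_mat k)"

definition hom_subst :: "nat \<Rightarrow> 'a::comm_ring_1 poly \<Rightarrow> 'a poly \<Rightarrow> 'a poly \<Rightarrow> 'a poly" where
  "hom_subst k f U W = (\<Sum>j\<le>k. Polynomial.smult (Polynomial.coeff f j) (U ^ (k - j) * W ^ j))"

lemma hom_subst_step:
  fixes f :: "'a::comm_ring_1 poly"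
  assumes "Polynomial.degree f \<le> k"
  shows "hom_subst (Suc k) ([:a, b:] * f) U W = (Polynomial.smult a U + Polynomial.smult b W) * hom_subst k f U W"
proof -
  have f: "Polynomial.coeff f (Suc k) = 0" using assms by (simp add: coeff_eq_0)
  have "hom_subst (Suc k) ([:a, b:] * f) U W
      = (\<Sum>j\<le>Suc k. Polynomial.smult (a * Polynomial.coeff f j) (U ^ (Suc k - j) * W ^ j))
        + (\<Sum>j\<le>Suc k. Polynomial.smult (case j of 0 \<Rightarrow> 0 | Suc i \<Rightarrow> b * Polynomial.coeff f i) (U ^ (Suc k - j) * W ^ j))"
    unfolding hom_subst_def sum.distrib[symmetric]
    by (intro sum.cong refl) (auto simp: coeff_pCons smult_add_left[symmetric] split: nat.splits)
  also have "(\<Sum>j\<le>Suc k. Polynomial.smult (a * Polynomial.coeff f j) (U ^ (Suc k - j) * W ^ j)) = Polynomial.smult a U * hom_subst k f U W"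
    by (simp add: f hom_subst_def sum_distrib_left Suc_diff_le algebra_simps)
  also have "(\<Sum>j\<le>Suc k. Polynomial.smult (case j of 0 \<Rightarrow> 0 | Suc i \<Rightarrow> b * Polynomial.coeff f i) (U ^ (Suc k - j) * W ^ j))
      = Polynomial.smult b W * hom_subst k f U W"
    by (subst sum.atMost_Suc_shift) (simp add: hom_subst_def sum_distrib_left algebra_simps)
  finally show ?thesis by (simp add: algebra_simps)
qed

lemma degree_linear_power:
  "Polynomial.degree ([:a, b:] ^ r * [:c, d:] ^ s :: 'a::comm_ring_1 poly) \<le> r + s"
proof -
  have lin: "Polynomial.degree ([:x, y:] ^ n :: 'a poly) \<le> n" for x y n
    by (rule order_trans[OF degree_power_le]) (auto simp: degree_pCons_le)
  show ?thesis by (rule order_trans[OF degree_mult_le]) (intro add_mono lin)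
qed

lemma hom_subst_linear:
  "hom_subst (r + s) ([:a, b:] ^ r * [:c, d:] ^ s) U W
   = (Polynomial.smult a U + Polynomial.smult b W) ^ r * (Polynomial.smult c U + Polynomial.smult d W) ^ s"
proof (induction r)
  case 0
  show ?case
  proof (induction s)
    case (Suc s)
    have "Polynomial.degree ([:c, d:] ^ s) \<le> s" using degree_linear_power[of 0 0 0 c d s] by simp
    from hom_subst_step[OF this, of c d U W] show ?case
      using Suc by (simp only: add_0 power_0 mult_1 power_Suc)
  qed (simp add: hom_subst_def)
next
  case (Suc r)
  show ?case
    using Suc hom_subst_step[OF degree_linear_power[of a b r c d s], of a b U W]
    by (simp only: add_Suc power_Suc mult.assoc)
qed

lemma sym_mat_carrier: "sym_mat k A \<in> carrier_mat (k + 1) (k + 1)"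
  by (simp add: sym_mat_def)

lemma sym_mat_mult:
  assumes A: "A \<in> carrier_mat 2 2" and B: "B \<in> carrier_mat 2 2"
  shows "sym_mat k (A * B) = sym_mat k A * sym_mat k B"
proof (rule eq_matI)
  fix i j assume "i < dim_row (sym_mat k A * sym_mat k B)" "j < dim_col (sym_mat k A * sym_mat k B)"
  then have ij: "i < k + 1" "j < k + 1" by (auto simp: sym_mat_def)
  then have kj: "k - j + j = k" by simp
  let ?U = "[:A $$ (0, 0), A $$ (1, 0):]" and ?W = "[:A $$ (0, 1), A $$ (1, 1):]"
  let ?f = "[:B $$ (0, 0), B $$ (1, 0):] ^ (k - j) * [:B $$ (0, 1), B $$ (1, 1):] ^ j"
  have AB: "(A * B) $$ (a, b) = A $$ (a, 0) * B $$ (0, b) + A $$ (a, 1) * B $$ (1, b)"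
    if "a < 2" "b < 2" for a b
    using mult_mat_index[OF A B that] by (simp add: numeral_2_eq_2)
  have col: "[:(A * B) $$ (0, b), (A * B) $$ (1, b):] = Polynomial.smult (B $$ (0, b)) ?U + Polynomial.smult (B $$ (1, b)) ?W"
    if "b < 2" for b
    using that by (simp add: AB del: index_mult_mat)
  have "(sym_mat k A * sym_mat k B) $$ (i, j) = (\<Sum>l<k + 1. sym_mat k A $$ (i, l) * sym_mat k B $$ (l, j))"
    using ij by (intro mult_mat_index) (auto simp: sym_mat_def)
  also have "\<dots> = (\<Sum>l\<le>k. Polynomial.coeff (?U ^ (k - l) * ?W ^ l) i * Polynomial.coeff ?f l)"
    using ij by (intro sum.cong) (auto simp: sym_mat_def)
  also have "\<dots> = Polynomial.coeff (hom_subst k ?f ?U ?W) i"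
    by (simp add: hom_subst_def coeff_sum mult.commute)
  also have "hom_subst k ?f ?U ?W = (Polynomial.smult (B $$ (0, 0)) ?U + Polynomial.smult (B $$ (1, 0)) ?W) ^ (k - j)
      * (Polynomial.smult (B $$ (0, 1)) ?U + Polynomial.smult (B $$ (1, 1)) ?W) ^ j"
    using hom_subst_linear[of "k - j" j, unfolded kj] .
  also have "Polynomial.coeff \<dots> i = sym_mat k (A * B) $$ (i, j)"
    using ij col[of 0] col[of 1] by (simp add: sym_mat_def del: index_mult_mat)
  finally show "sym_mat k (A * B) $$ (i, j) = (sym_mat k A * sym_mat k B) $$ (i, j)" by simp
qed (auto simp: sym_mat_def)

lemma Sym_rep: "rdim (Sym_rep k :: 'a::finite_field GL2_rep) = k + 1"
  "ract (Sym_rep k :: 'a GL2_rep) = sym_mat k"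
proof -
  have "sym_mat k \<in> hom (GL 2) (GL (k + 1) :: 'a mat monoid)"
  proof (rule GL_homI)
    have "[:0, 1 :: 'a:] ^ j = Polynomial.monom 1 j" for j by (simp add: monom_altdef)
    then show "sym_mat k (1\<^sub>m 2) = (1\<^sub>m (k + 1) :: 'a mat)"
      by (intro eq_matI) (auto simp: sym_mat_def one_pCons[symmetric])
  qed (simp_all only: carrier_GL sym_mat_mult sym_mat_carrier)
  from mk_rep[OF this] show "rdim (Sym_rep k :: 'a GL2_rep) = k + 1" "ract (Sym_rep k :: 'a GL2_rep) = sym_mat k"
    by (simp_all add: Sym_rep_def)
qed

definition M_class :: "int \<Rightarrow> 'a::finite_field K0" where
  "M_class k =
     (if k \<ge> 0 then K0_class (Sym_rep (nat k))
      else if k = -1 then 0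
      else - (det_class_power (1 + k) * K0_class (Sym_rep (nat (- k - 2)))))"

lemma M_class_neg: "k \<le> -2 \<Longrightarrow> M_class k = - (det_class_power (1 + k) * M_class (- k - 2))"
  by (simp add: M_class_def)

end

(*
  Multiplication Sym^1 x Sym^k -> Sym^(k+1) has kernel e Sym^(k-1), whence
  M_1 M_k = M_(k+1) + e M_(k-1) for all integers k (for negative k by the reflection
  M_(-k-2) = -e^(-1-k) M_k).  In characteristic p, differentiation with respect to one of the
  variables maps Sym^p onto e Sym^(p-2), with kernel spanned by the p-th powers of the variables,
  i.e. M_p = M_1^[1] + e M_(p-2).  Together these give M_k M_1^[1] = M_(k+p) + e^p M_(k-p), and the
  theorem follows by expanding M_(k-p) M_1^[1] M_h^[1] in two ways and twisting.
*)

theory Submission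
  imports Defs
begin

section \<open>The tensor product of \<open>Sym\<^sup>k\<close> with the standard representation\<close>

lemma sum_single:
  fixes x :: "'b::semiring_0" and a N :: nat
  shows "(\<Sum>k<N. (if k = a then x else 0) * f k) = (if a < N then x * f a else 0)"
    and "(\<Sum>k<N. f k * (if k = a then x else 0)) = (if a < N then f a * x else 0)"
  by (simp_all add: if_distrib[of "\<lambda>z. z * _"] if_distrib[of "\<lambda>z. _ * z"] cong: if_cong)

lemma sym_mat_index:
  assumes "i \<le> k" "j \<le> k"
  shows "sym_mat k A $$ (i, j) =
    Polynomial.coeff ([:A $$ (0, 0), A $$ (1, 0):] ^ (k - j) * [:A $$ (0, 1), A $$ (1, 1):] ^ j) i"
  using assms by (simp add: sym_mat_def)

lemma sym_mat_1_index:
  assumes "i < 2" "j < 2"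
  shows "sym_mat 1 A $$ (i, j) = A $$ (i, j)"
  using assms by (auto simp: sym_mat_def less_2_cases_iff)

lemma det_2x2:
  assumes "A \<in> carrier (GL 2)"
  shows "det A = A $$ (0, 0) * A $$ (1, 1) - A $$ (0, 1) * A $$ (1, 0)"
proof -
  have A: "A \<in> carrier_mat 2 2" using assms by (simp add: carrier_GL)
  have "det (mat_delete A i 0) = mat_delete A i 0 $$ (0, 0)" for i
    using A by (intro det_single) (simp add: mat_delete_def)
  then show ?thesis
    using A laplace_expansion_column[OF A, of 0]
    by (simp add: cofactor_def mat_delete_def numeral_2_eq_2 insert_index_def)
qed

lemma det_rep:
  shows "rdim (det_rep :: 'a::finite_field GL2_rep) = 1"
    and "ract det_rep = (\<lambda>A :: 'a mat. mat 1 1 (\<lambda>_. det A))"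
  using det_power_rep[of 1, where ?'a = 'a] by (simp_all add: det_rep_def)

lemma det_tensor:
  fixes V :: "'a::finite_field GL2_rep"
  shows "rdim (rep_tensor det_rep V) = rdim V"
    and "ract (rep_tensor det_rep V) = (\<lambda>A. det A \<cdot>\<^sub>m ract V A)"
proof -
  have k: "kronecker (mat 1 1 (\<lambda>_. x)) B = x \<cdot>\<^sub>m B" for x :: 'a and B
    by (intro eq_matI) (auto simp: kronecker_def)
  show "rdim (rep_tensor det_rep V) = rdim V"
    and "ract (rep_tensor det_rep V) = (\<lambda>A. det A \<cdot>\<^sub>m ract V A)"
    by (simp_all only: rep_tensor det_rep k mult_1_left)
qed

section \<open>The exact sequence of multiplication and syzygies\<close>

text \<open>
  In the basis \<open>e\<^sub>a \<otimes> t\<^sup>b\<close> of \<open>Sym\<^sup>1 \<otimes> Sym\<^sup>n\<^sup>-\<^sup>1\<close>, which has index \<open>a n + b\<close>, the first matrix below is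
  the multiplication map \<open>(f\<^sub>0, f\<^sub>1) \<mapsto> f\<^sub>0 + t f\<^sub>1\<close> and the second one \<open>f \<mapsto> (t f, - f)\<close>.
\<close>

definition mul_mat :: "nat \<Rightarrow> 'a::finite_field mat" where
  "mul_mat n = mat (n + 1) (2 * n) (\<lambda>(i, r).
     (if r = i then if i < n then 1 else 0 else 0)
     + (if r = n - 1 + i then if 0 < i then 1 else 0 else 0))"

definition syzygy_mat :: "nat \<Rightarrow> 'a::finite_field mat" where
  "syzygy_mat n = mat (2 * n) (n - 1) (\<lambda>(r, j).
     (if r = j + 1 then 1 else 0) - (if r = n + j then 1 else 0))"

text \<open>The splitting separates the constant term: \<open>?P'\<close> is (f_0, f_1) |-> (f_0 -
  f_0(0)) / t, and \<open>?Q'\<close> is g |-> (g(0), (g - g(0)) / t).\<close>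

lemma mul_mat_split:
  assumes "n \<ge> 2"
  shows "mat_split (n - 1) (2 * n) (n + 1) (syzygy_mat n) (mul_mat n)
    (mat (n - 1) (2 * n) (\<lambda>(i, r). if r = i + 1 then 1 else 0))
    (mat (2 * n) (n + 1) (\<lambda>(r, j). if r = (if j = 0 then 0 else n - 1 + j) then 1 else 0))
    " (is "mat_split _ _ _ ?P ?Q ?P' ?Q'")
proof -
  have c: "?P \<in> carrier_mat (2 * n) (n - 1)" "?Q \<in> carrier_mat (n + 1) (2 * n)"
    "?P' \<in> carrier_mat (n - 1) (2 * n)" "?Q' \<in> carrier_mat (2 * n) (n + 1)"
    by (simp_all add: mul_mat_def syzygy_mat_def)
  have "?P' * ?P = 1\<^sub>m (n - 1)"
  proof (rule eq_matI)
    fix i j assume "i < dim_row (1\<^sub>m (n - 1) :: 'a mat)" "j < dim_col (1\<^sub>m (n - 1) :: 'a mat)"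
    then show "(?P' * ?P) $$ (i, j) = 1\<^sub>m (n - 1) $$ (i, j)"
      by (subst mult_mat_index[OF c(3,1)]) (auto simp: sum_single syzygy_mat_def)
  qed (use c in auto)
  moreover have "?Q * ?Q' = 1\<^sub>m (n + 1)"
  proof (rule eq_matI)
    fix i j assume "i < dim_row (1\<^sub>m (n + 1) :: 'a mat)" "j < dim_col (1\<^sub>m (n + 1) :: 'a mat)"
    then show "(?Q * ?Q') $$ (i, j) = 1\<^sub>m (n + 1) $$ (i, j)"
      using assms by (subst mult_mat_index[OF c(2,4)]) (auto simp: sum_single mul_mat_def)
  qed (use c in auto)
  moreover have "?Q * ?P = 0\<^sub>m (n + 1) (n - 1)"
  proof (rule eq_matI)
    fix i j assume "i < dim_row (0\<^sub>m (n + 1) (n - 1) :: 'a mat)"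
      "j < dim_col (0\<^sub>m (n + 1) (n - 1) :: 'a mat)"
    then show "(?Q * ?P) $$ (i, j) = 0\<^sub>m (n + 1) (n - 1) $$ (i, j)"
      using assms
      by (subst mult_mat_index[OF c(2,1)])
        (auto simp: syzygy_mat_def right_diff_distrib sum_subtractf sum_single mul_mat_def)
  qed (use c in auto)
  moreover have "?P' * ?Q' = 0\<^sub>m (n - 1) (n + 1)"
  proof (rule eq_matI)
    fix i j assume "i < dim_row (0\<^sub>m (n - 1) (n + 1) :: 'a mat)"
      "j < dim_col (0\<^sub>m (n - 1) (n + 1) :: 'a mat)"
    then show "(?P' * ?Q') $$ (i, j) = 0\<^sub>m (n - 1) (n + 1) $$ (i, j)"
      using assms by (subst mult_mat_index[OF c(3,4)]) (auto simp: sum_single)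
  qed (use c in auto)
  moreover have "?P * ?P' + ?Q' * ?Q = 1\<^sub>m (2 * n)"
  proof (rule eq_matI)
    fix i j assume "i < dim_row (1\<^sub>m (2 * n) :: 'a mat)" "j < dim_col (1\<^sub>m (2 * n) :: 'a mat)"
    then have ij: "i < 2 * n" "j < 2 * n" by auto
    \<comment> \<open>The condition j = k + 1 is solved for k so that \<open>sum_single\<close>
      applies; the guard 0 < j excludes the truncated value of j - 1.\<close>
    have "(?P * ?P') $$ (i, j)
        = (\<Sum>k<n - 1. (if k = j - 1 then if 0 < j then 1 else 0 else 0) * ?P $$ (i, k))"
      unfolding mult_mat_index[OF c(1,3) ij] using ij by (intro sum.cong refl) auto
    also have "\<dots> = (if 0 < j \<and> j < n then ?P $$ (i, j - 1) else 0)"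
      using assms by (auto simp: sum_single)
    finally have 1: "(?P * ?P') $$ (i, j) = (if 0 < j \<and> j < n then ?P $$ (i, j - 1) else 0)" .
    have "(?Q' * ?Q) $$ (i, j)
        = (\<Sum>k<n + 1. (if k = (if i = 0 then 0 else i - (n - 1))
            then if i = 0 \<or> n \<le> i then 1 else 0 else 0) * ?Q $$ (k, j))"
      unfolding mult_mat_index[OF c(4,2) ij] using ij assms by (intro sum.cong refl) auto
    also have "\<dots> = (if i = 0 then ?Q $$ (0, j) else if n \<le> i then ?Q $$ (i - (n - 1), j) else 0)"
      using ij assms by (auto simp: sum_single)
    finally have 2: "(?Q' * ?Q) $$ (i, j) = \<dots>" .
    have "(?P * ?P' + ?Q' * ?Q) $$ (i, j) = (?P * ?P') $$ (i, j) + (?Q' * ?Q) $$ (i, j)"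
      using ij c by (simp del: index_mult_mat(1))
    also have "\<dots> = 1\<^sub>m (2 * n) $$ (i, j)"
    proof -
      consider "i = 0" | "0 < i" "i < n" | "n \<le> i" by linarith
      then show ?thesis
      proof cases
        case 3
        then show ?thesis
          unfolding 1 2 using ij assms by (cases "i = j"; cases "j < n") (auto simp: syzygy_mat_def mul_mat_def)
      qed (unfold 1 2, use ij assms in \<open>auto simp: syzygy_mat_def mul_mat_def\<close>)
    qed
    finally show "(?P * ?P' + ?Q' * ?Q) $$ (i, j) = 1\<^sub>m (2 * n) $$ (i, j)" .
  qed (use c in auto)
  ultimately show ?thesis using c by (simp add: mat_split_def)
qed

lemma coeff_linear_mult:
  "Polynomial.coeff ([:x, y:] * f) i = x * Polynomial.coeff f i + (if i = 0 then 0 else y * Polynomial.coeff f (i - 1))"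
  by (cases i) (simp_all add: coeff_pCons)

lemma sym_tensor_index:
  assumes "a < 2" "b \<le> k" "c < 2" "d \<le> k"
  shows "kronecker (sym_mat 1 A) (sym_mat k A) $$ (a * (k + 1) + b, c * (k + 1) + d) = A $$ (a, c) *
    Polynomial.coeff ([:A $$ (0, 0), A $$ (1, 0):] ^ (k - d) * [:A $$ (0, 1), A $$ (1, 1):] ^ d) b"
proof -
  have dm: "(x * n + y) div n = x \<and> (x * n + y) mod n = y" if "y < n" for x y n :: nat
    using that by simp
  have "a * (k + 1) + b < (1 + 1) * (k + 1)" "c * (k + 1) + d < (1 + 1) * (k + 1)"
    using assms by (intro pair_less_prod; simp)+
  moreover have "(a * (k + 1) + b) div (k + 1) = a" "(c * (k + 1) + d) div (k + 1) = c"
    "(a * (k + 1) + b) mod (k + 1) = b" "(c * (k + 1) + d) mod (k + 1) = d"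
    using assms dm[of b "k + 1"] dm[of d "k + 1"] by auto
  ultimately show ?thesis
    using kronecker_index[OF sym_mat_carrier[of 1 A] sym_mat_carrier[of k A], of "a * (k + 1) + b" "c * (k + 1) + d"]
    by (simp only: sym_mat_1_index sym_mat_index assms)
qed

text \<open>Column a of A, read as a polynomial, is \<open>?U\<close> or \<open>?W\<close>. Hence
  the image of the basis element (a, b) multiplies out to one more factor \<open>?U\<close> or
  \<open>?W\<close>, which is column a + b of the next symmetric power.\<close>

lemma mul_mat_intertwines:
  fixes A :: "'a::finite_field mat"
  assumes "A \<in> carrier (GL 2)" and k: "k \<ge> 1"
  shows "mul_mat (k + 1) * kronecker (sym_mat 1 A) (sym_mat k A) = sym_mat (k + 1) A * mul_mat (k + 1)"
    (is "?Q * ?K = ?S * ?Q")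
proof (rule eq_matI)
  have c: "?Q \<in> carrier_mat (k + 2) (2 * (k + 1))" "?K \<in> carrier_mat (2 * (k + 1)) (2 * (k + 1))"
    "?S \<in> carrier_mat (k + 2) (k + 2)"
    using kronecker_carrier[OF sym_mat_carrier[of 1 A] sym_mat_carrier[of k A]] sym_mat_carrier[of "k + 1" A]
    by (simp_all add: mul_mat_def mult_2)
  fix i s assume "i < dim_row (?S * ?Q)" "s < dim_col (?S * ?Q)"
  then have is': "i < k + 2" "s < 2 * (k + 1)" using c by auto
  define a b where "a = s div (k + 1)" and "b = s mod (k + 1)"
  have "s = a * (k + 1) + b" unfolding a_def b_def by (rule div_mult_mod_eq[symmetric])
  moreover have "b < k + 1" "a < 2"
    using is' by (simp_all add: a_def b_def less_mult_imp_div_less)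
  ultimately have s: "s = a * (k + 1) + b" "b \<le> k" "a < 2" by simp_all
  let ?U = "[:A $$ (0, 0), A $$ (1, 0):]" and ?W = "[:A $$ (0, 1), A $$ (1, 1):]"
  let ?f = "?U ^ (k - b) * ?W ^ b"
  \<comment> \<open>Handles the top row i = k + 1, where f_0 contributes nothing.\<close>
  have f: "Polynomial.coeff ?f (Suc k) = 0"
    using s degree_linear_power[of "A $$ (0, 0)" "A $$ (1, 0)" "k - b" "A $$ (0, 1)" "A $$ (1, 1)" b]
    by (intro coeff_eq_0) auto
  have K0: "?K $$ (i, s) = A $$ (0, a) * Polynomial.coeff ?f i" if "i \<le> k"
    using sym_tensor_index[of 0 i k a b A] that s by simp
  \<comment> \<open>Row k + i is 1 * (k + 1) + (i - 1), hence coefficient i - 1 of f_1.\<close>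
  have K1: "?K $$ (k + i, s) = A $$ (1, a) * Polynomial.coeff ?f (i - 1)" if "0 < i"
    using sym_tensor_index[of 1 "i - 1" k a b A] that s is' by simp
  have "(?Q * ?K) $$ (i, s) = (if i \<le> k then ?K $$ (i, s) else 0) + (if 0 < i then ?K $$ (k + i, s) else 0)"
    unfolding mult_mat_index[OF c(1,2) is'] using is'
    by (auto simp: mul_mat_def sum.distrib distrib_right sum_single)
  also have "\<dots> = Polynomial.coeff ([:A $$ (0, a), A $$ (1, a):] * ?f) i"
    using is' f K0 K1 unfolding coeff_linear_mult by (cases "i = Suc k") auto
  also have "[:A $$ (0, a), A $$ (1, a):] * ?f = ?U ^ (k + 1 - (a + b)) * ?W ^ (a + b)"
    using s by (cases "a = 0")
      (auto simp: Suc_diff_le less_2_cases_iff mult.assoc mult.left_commute simp del: mult_pCons_left mult_pCons_right)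
  also have "Polynomial.coeff \<dots> i = ?S $$ (i, a + b)"
    using is' s by (simp add: sym_mat_index)
  \<comment> \<open>Column s of \<open>?Q\<close> has its only nonzero entry in row a + b.\<close>
  also have "\<dots> = (\<Sum>j<k + 2. ?S $$ (i, j) * (if j = a + b then 1 else 0))"
    using s by (simp add: sum_single)
  also have "\<dots> = (\<Sum>j<k + 2. ?S $$ (i, j) * ?Q $$ (j, s))"
    using is' s by (intro sum.cong refl) (auto simp: mul_mat_def less_2_cases_iff)
  also have "\<dots> = (?S * ?Q) $$ (i, s)"
    using mult_mat_index[OF c(3,1) is'] by simp
  finally show "(?Q * ?K) $$ (i, s) = (?S * ?Q) $$ (i, s)" .
qed (auto simp: mul_mat_def sym_mat_def kronecker_def)

text \<open>The syzygy (t, -1) is an antisymmetric tensor, which A scales by its determinant: A_00 W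
  - A_01 U = t det A and A_10 W - A_11 U = - det A.\<close>

lemma syzygy_mat_intertwines:
  fixes A :: "'a::finite_field mat"
  assumes A: "A \<in> carrier (GL 2)" and k: "k \<ge> 1"
  shows "syzygy_mat (k + 1) * (det A \<cdot>\<^sub>m sym_mat (k - 1) A)
    = kronecker (sym_mat 1 A) (sym_mat k A) * syzygy_mat (k + 1)"
    (is "?P * (_ \<cdot>\<^sub>m ?S) = ?K * ?P")
proof (rule eq_matI)
  have c: "?P \<in> carrier_mat (2 * (k + 1)) k" "?K \<in> carrier_mat (2 * (k + 1)) (2 * (k + 1))"
    "?S \<in> carrier_mat k k" "det A \<cdot>\<^sub>m ?S \<in> carrier_mat k k"
    using kronecker_carrier[OF sym_mat_carrier[of 1 A] sym_mat_carrier[of k A]]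
      sym_mat_carrier[of "k - 1" A] k
    by (simp_all add: syzygy_mat_def mult_2)
  fix r j assume "r < dim_row (?K * ?P)" "j < dim_col (?K * ?P)"
  then have rj: "r < 2 * (k + 1)" "j < k" using c by auto
  define a b where "a = r div (k + 1)" and "b = r mod (k + 1)"
  have "r = a * (k + 1) + b" unfolding a_def b_def by (rule div_mult_mod_eq[symmetric])
  moreover have "b < k + 1" "a < 2"
    using rj by (simp_all add: a_def b_def less_mult_imp_div_less)
  ultimately have r: "r = a * (k + 1) + b" "b \<le> k" "a < 2" by simp_all
  let ?U = "[:A $$ (0, 0), A $$ (1, 0):]" and ?W = "[:A $$ (0, 1), A $$ (1, 1):]"
  let ?f = "?U ^ (k - 1 - j) * ?W ^ j"
  have f: "Polynomial.coeff ?f k = 0"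
    using rj degree_linear_power[of "A $$ (0, 0)" "A $$ (1, 0)" "k - 1 - j" "A $$ (0, 1)" "A $$ (1, 1)" j]
    by (intro coeff_eq_0) auto
  have S: "?S $$ (i, j) = Polynomial.coeff ?f i" if "i < k" for i
    using that rj by (simp add: sym_mat_index)
  have "(?P * (det A \<cdot>\<^sub>m ?S)) $$ (r, j) = (\<Sum>i<k. ?P $$ (r, i) * (det A * ?S $$ (i, j)))"
    unfolding mult_mat_index[OF c(1,4) rj] using rj c(3) by (intro sum.cong refl) auto
  \<comment> \<open>Row r of \<open>?P\<close> has entry 1 in column b - 1 if a = 0, and -1 in
    column b if a = 1; the case a = b = 0 is set to 0 because b - 1 truncates.\<close>
  also have "\<dots> = (\<Sum>i<k. (if i = b - (1 - a)
      then if a = 0 \<and> b = 0 then 0 else if a = 0 then 1 else - 1 else 0) * (det A * ?S $$ (i, j)))"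
    using rj r by (intro sum.cong refl) (auto simp: syzygy_mat_def less_2_cases_iff)
  also have "\<dots> = (if a = 0 then if b = 0 then 0 else det A * Polynomial.coeff ?f (b - 1)
      else - det A * Polynomial.coeff ?f b)"
    using r f S k by (cases "b = k") (auto simp: sum_single less_2_cases_iff)
  also have "\<dots> = A $$ (a, 0) * Polynomial.coeff (?W * ?f) b - A $$ (a, 1) * Polynomial.coeff (?U * ?f) b"
    unfolding coeff_linear_mult det_2x2[OF A] using r by (auto simp: less_2_cases_iff algebra_simps)
  also have "\<dots> = ?K $$ (r, j + 1) - ?K $$ (r, k + 1 + j)"
  proof -
    have 1: "?W * ?f = ?U ^ (k - (j + 1)) * ?W ^ (j + 1)"
      by (simp add: mult.left_commute del: mult_pCons_left mult_pCons_right)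
    have 2: "?U * ?f = ?U ^ (k - j) * ?W ^ j"
      using rj by (simp only: mult.assoc[symmetric] power_Suc[symmetric]) (simp add: Suc_diff_Suc)
    show ?thesis
      using sym_tensor_index[of a b k 0 "j + 1" A] sym_tensor_index[of a b k 1 j A] rj r
      unfolding 1 2 by simp
  qed
  also have "\<dots> = (\<Sum>i<2 * (k + 1). ?K $$ (r, i) * ?P $$ (i, j))"
    using rj by (simp add: syzygy_mat_def right_diff_distrib sum_subtractf sum_single)
  also have "\<dots> = (?K * ?P) $$ (r, j)"
    using mult_mat_index[OF c(2,1) rj] by simp
  finally show "(?P * (det A \<cdot>\<^sub>m ?S)) $$ (r, j) = (?K * ?P) $$ (r, j)" .
qed (use k in \<open>auto simp: syzygy_mat_def sym_mat_def kronecker_def\<close>)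


text \<open>Read off from the sequence of syzygies and products. At k = 0 truncated subtraction
  would replace M_(-1) = 0 by M_0.\<close>

lemma K0_class_V_mult_Sym:
  assumes "k \<ge> 1"
  shows "K0_class (Sym_rep 1) * K0_class (Sym_rep k)
    = K0_class (Sym_rep (k + 1)) + det_class * (K0_class (Sym_rep (k - 1)) :: 'a::finite_field K0)"
proof -
  let ?T = "rep_tensor (Sym_rep 1) (Sym_rep k) :: 'a GL2_rep"
  let ?D = "rep_tensor det_rep (Sym_rep (k - 1)) :: 'a GL2_rep"
  have dims: "rdim ?T = 2 * (k + 1)" "rdim ?D = k + 1 - 1" "rdim (Sym_rep (k + 1) :: 'a GL2_rep) = k + 1 + 1"
    using assms by (simp_all add: rep_tensor[of "Sym_rep 1"] Sym_rep det_tensor del: One_nat_def)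
  have "intertwiner ?D ?T (syzygy_mat (k + 1))" "intertwiner ?T (Sym_rep (k + 1)) (mul_mat (k + 1))"
    unfolding intertwiner_def dims
    using mul_mat_intertwines[OF _ assms] syzygy_mat_intertwines[OF _ assms]
    by (auto simp only: rep_tensor[of "Sym_rep 1"] Sym_rep det_tensor) (simp_all add: mul_mat_def syzygy_mat_def)
  moreover have "\<exists>P' Q'. mat_split (rdim ?D) (rdim ?T) (rdim (Sym_rep (k + 1) :: 'a GL2_rep))
      (syzygy_mat (k + 1)) (mul_mat (k + 1)) P' Q'"
    unfolding dims by (intro exI, rule mul_mat_split) (use assms in simp)
  ultimately have "short_exact ?D ?T (Sym_rep (k + 1))"
    unfolding short_exact_split by blast
  from K0_class_exact[OF this] show ?thesis
    by (simp add: K0_class_tensor det_class_def add.commute)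
qed

section \<open>The recurrence for all integer indices\<close>

text \<open>For k >= 0 this is the definition. The reflection k |-> - k - 2 is an involution and e
  is invertible, so the formula can be inverted for k <= -2; at the fixed point -1 both sides
  vanish.\<close>

lemma M_class_reflect: "M_class (- k - 2) = - (det_class_power (- 1 - k) * (M_class k :: 'a::finite_field K0))"
proof -
  consider "k \<ge> 0" | "k = -1" | "k \<le> -2" by linarith
  then show ?thesis
  proof cases
    case 1
    then show ?thesis using M_class_neg[of "- k - 2", where ?'a = 'a] by simp
  next
    case 3
    have "det_class_power (- 1 - k) * det_class_power (1 + k) = (det_class_power 0 :: 'a K0)"
      by (simp flip: det_class_power_add)
    also have "\<dots> = 1" using det_class_power_nat[of 0, where ?'a = 'a] by simp
    finally show ?thesis using M_class_neg[OF 3, where ?'a = 'a] by (simp add: mult.assoc[symmetric])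
  qed (simp add: M_class_def)
qed

lemma det_class_power_1: "det_class_power 1 = (det_class :: 'a::finite_field K0)"
  using det_class_power_nat[of 1, where ?'a = 'a] by simp

lemma M_class_0: "M_class 0 = (1 :: 'a::finite_field K0)"
proof -
  have "sym_mat 0 A = (1\<^sub>m 1 :: 'a mat)" for A by (intro eq_matI) (auto simp: sym_mat_def)
  then have "K0_class (Sym_rep 0) = K0_class (triv_rep :: 'a GL2_rep)"
    by (intro rep_class_cong) (simp_all only: Sym_rep triv_rep add_0)
  then show ?thesis by (simp add: M_class_def K0_class_triv)
qed

text \<open>Reflection exchanges the neighbours k + 1 and k - 1 and moves the factor e between them,
  so the case k <= -2 follows from - k - 2 >= 0. At the fixed point k = -1 the claim is 0 = 1 - e
  e^(-1).\<close>

lemma M_class_1_mult: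
  "M_class 1 * M_class k = M_class (k + 1) + det_class * (M_class (k - 1) :: 'a::finite_field K0)"
proof -
  have nonneg: "M_class 1 * M_class k = M_class (k + 1) + det_class * (M_class (k - 1) :: 'a K0)"
    if "k \<ge> 0" for k
  proof (cases "k = 0")
    case False
    then have "nat k \<ge> 1" "nat (k + 1) = nat k + 1" "nat (k - 1) = nat k - 1" using that by auto
    then show ?thesis
      using K0_class_V_mult_Sym[of "nat k", where ?'a = 'a] that False by (simp add: M_class_def)
  qed (simp add: M_class_0 M_class_def[of "-1"])
  consider "k \<ge> 0" | "k = -1" | "k \<le> -2" by linarith
  then show ?thesis
  proof cases
    case 2
    have "det_class * det_class_power (-1) = (det_class_power 0 :: 'a K0)"
      unfolding det_class_power_1[symmetric] by (simp flip: det_class_power_add)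
    also have "\<dots> = 1" using det_class_power_nat[of 0, where ?'a = 'a] by simp
    finally show ?thesis
      using 2 M_class_reflect[of 0, where ?'a = 'a] by (simp add: M_class_0 M_class_def[of "-1"])
  next
    case 3
    define m where "m = - k - 2"
    have m: "m \<ge> 0" using 3 by (simp add: m_def)
    have k: "k = - m - 2" "k + 1 = - (m - 1) - 2" "k - 1 = - (m + 1) - 2" by (simp_all add: m_def)
    have e: "det_class * det_class_power (- 1 - (m + 1)) = (det_class_power (- 1 - m) :: 'a K0)"
      "det_class_power (- 1 - (m - 1)) = det_class_power (- 1 - m) * (det_class :: 'a K0)"
      unfolding det_class_power_1[symmetric] by (simp_all flip: det_class_power_add)
    have "M_class 1 * M_class k = - (det_class_power (- 1 - m) * (M_class 1 * (M_class m :: 'a K0)))"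
      unfolding k M_class_reflect by (simp add: mult.left_commute)
    also have "\<dots> = M_class (k + 1) + det_class * M_class (k - 1)"
      unfolding nonneg[OF m] k(2,3) M_class_reflect mult_minus_right mult.assoc[symmetric] e
      by (simp add: algebra_simps)
    finally show ?thesis .
  qed (use nonneg in auto)
qed

section \<open>The Frobenius twist of the standard representation\<close>

text \<open>
  The first matrix below maps the basis \<open>1, t\<close> of \<open>Sym\<^sup>1\<close> to \<open>1, t\<^sup>p\<close>.  The second one is \<open>f \<mapsto> f'\<close>; the
  coefficient of \<open>t\<^sup>p\<^sup>-\<^sup>1\<close> in \<open>f'\<close> vanishes in characteristic \<open>p\<close>.
\<close>

definition frob_mat :: "nat \<Rightarrow> 'a::finite_field mat" where
  "frob_mat p = mat (p + 1) 2 (\<lambda>(r, j). if r = j * p then 1 else 0)"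

definition deriv_mat :: "nat \<Rightarrow> 'a::finite_field mat" where
  "deriv_mat p = mat (p - 1) (p + 1) (\<lambda>(i, r). if r = i + 1 then of_nat (i + 1) else 0)"

text \<open>The factors 1, ..., p - 1 of the derivative are invertible in characteristic p.
  \<open>?Q'\<close> is termwise integration, and \<open>?P'\<close> reads the coefficients of 1 and
  t^p, which differentiation kills.\<close>

lemma frob_deriv_mat_split:
  assumes p: "CHAR('a::finite_field) = p"
  shows "mat_split 2 (p + 1) (p - 1) (frob_mat p) (deriv_mat p :: 'a mat)
    (mat 2 (p + 1) (\<lambda>(j, r). if r = j * p then 1 else 0))
    (mat (p + 1) (p - 1) (\<lambda>(r, i). if r = i + 1 then inverse (of_nat (i + 1)) else 0))"
    (is "mat_split _ _ _ ?P ?Q ?P' ?Q'")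
proof -
  have "p > 1" using prime_gt_1_nat[OF CHAR_prime[where ?'a = 'a]] p by simp
  have inv: "of_nat r * inverse (of_nat r) = (1 :: 'a)" if "0 < r" "r < p" for r
    using that p of_nat_eq_0_iff_char_dvd[of r, where ?'a = 'a] by (auto dest: dvd_imp_le)
  have c: "?P \<in> carrier_mat (p + 1) 2" "?Q \<in> carrier_mat (p - 1) (p + 1)"
    "?P' \<in> carrier_mat 2 (p + 1)" "?Q' \<in> carrier_mat (p + 1) (p - 1)"
    by (simp_all add: frob_mat_def deriv_mat_def)
  have "?P' * ?P = 1\<^sub>m 2"
  proof (rule eq_matI)
    fix i j assume "i < dim_row (1\<^sub>m 2 :: 'a mat)" "j < dim_col (1\<^sub>m 2 :: 'a mat)"
    then show "(?P' * ?P) $$ (i, j) = 1\<^sub>m 2 $$ (i, j)"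
      using \<open>p > 1\<close>
      by (subst mult_mat_index[OF c(3,1)]) (auto simp: sum_single frob_mat_def less_2_cases_iff simp del: sum.lessThan_Suc)
  qed (use c in auto)
  moreover have "?Q * ?Q' = 1\<^sub>m (p - 1)"
  proof (rule eq_matI)
    fix i j assume "i < dim_row (1\<^sub>m (p - 1) :: 'a mat)" "j < dim_col (1\<^sub>m (p - 1) :: 'a mat)"
    then show "(?Q * ?Q') $$ (i, j) = 1\<^sub>m (p - 1) $$ (i, j)"
      using inv[of "Suc i"]
      by (subst mult_mat_index[OF c(2,4)]) (auto simp: sum_single deriv_mat_def simp del: sum.lessThan_Suc of_nat_Suc)
  qed (use c in auto)
  moreover have "?Q * ?P = 0\<^sub>m (p - 1) 2"
  proof (rule eq_matI)
    fix i j assume "i < dim_row (0\<^sub>m (p - 1) 2 :: 'a mat)" "j < dim_col (0\<^sub>m (p - 1) 2 :: 'a mat)"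
    then show "(?Q * ?P) $$ (i, j) = 0\<^sub>m (p - 1) 2 $$ (i, j)"
      by (subst mult_mat_index[OF c(2,1)])
        (auto simp: sum_single deriv_mat_def frob_mat_def less_2_cases_iff simp del: sum.lessThan_Suc of_nat_Suc)
  qed (use c in auto)
  moreover have "?P' * ?Q' = 0\<^sub>m 2 (p - 1)"
  proof (rule eq_matI)
    fix i j assume "i < dim_row (0\<^sub>m 2 (p - 1) :: 'a mat)" "j < dim_col (0\<^sub>m 2 (p - 1) :: 'a mat)"
    then show "(?P' * ?Q') $$ (i, j) = 0\<^sub>m 2 (p - 1) $$ (i, j)"
      by (subst mult_mat_index[OF c(3,4)])
        (auto simp: sum_single less_2_cases_iff simp del: sum.lessThan_Suc of_nat_Suc)
  qed (use c in auto)
  moreover have "?P * ?P' + ?Q' * ?Q = 1\<^sub>m (p + 1)"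
  proof (rule eq_matI)
    fix i j assume "i < dim_row (1\<^sub>m (p + 1) :: 'a mat)" "j < dim_col (1\<^sub>m (p + 1) :: 'a mat)"
    then have ij: "i < p + 1" "j < p + 1" by auto
    have 1: "(?P * ?P') $$ (i, j) = (if i = j \<and> (i = 0 \<or> i = p) then 1 else 0)"
      using ij \<open>p > 1\<close> by (subst mult_mat_index[OF c(1,3)]) (auto simp: frob_mat_def numeral_2_eq_2)
    \<comment> \<open>For i = 0 the inner conditional gives 0; for i = p the index p - 1 lies
      outside the sum.\<close>
    have "(?Q' * ?Q) $$ (i, j)
        = (\<Sum>k<p - 1. (if k = i - 1 then if i = 0 then 0 else inverse (of_nat i) else 0) * ?Q $$ (k, j))"
      unfolding mult_mat_index[OF c(4,2) ij] using ij by (intro sum.cong refl) (auto simp del: of_nat_Suc)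
    also have "\<dots> = (if i = j \<and> 0 < i \<and> i < p then 1 else 0)"
      using ij inv[of i] \<open>p > 1\<close>
      by (auto simp: sum_single deriv_mat_def mult.commute simp del: of_nat_Suc)
    finally have 2: "(?Q' * ?Q) $$ (i, j) = \<dots>" .
    have "(?P * ?P' + ?Q' * ?Q) $$ (i, j) = (?P * ?P') $$ (i, j) + (?Q' * ?Q) $$ (i, j)"
      using ij c by (simp del: index_mult_mat(1))
    also have "\<dots> = 1\<^sub>m (p + 1) $$ (i, j)"
      unfolding 1 2 using ij by auto
    finally show "(?P * ?P' + ?Q' * ?Q) $$ (i, j) = 1\<^sub>m (p + 1) $$ (i, j)" .
  qed (use c in auto)
  ultimately show ?thesis using c by (simp add: mat_split_def)
qed

lemma linear_power_CHAR:
  fixes x y :: "'a::finite_field"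
  shows "[:x, y:] ^ CHAR('a) = [:frob x:] + Polynomial.monom (frob y) (CHAR('a))"
proof -
  have "[:x, y:] = [:x:] + Polynomial.monom y 1" by (simp add: monom_Suc monom_0)
  moreover have "([:x:] + Polynomial.monom y 1) ^ CHAR('a) = [:x:] ^ CHAR('a) + Polynomial.monom y 1 ^ CHAR('a)"
    by (rule freshmans_dream) (simp_all add: CHAR_prime)
  ultimately show ?thesis by (simp only: monom_power frob_def poly_const_pow mult_1)
qed

text \<open>Columns 0 and p of Sym^p are the p-th powers of the columns of A, and (x + y t)^p = x^p
  + y^p t^p. So A acts on the span of 1 and t^p through its Frobenius image.\<close>

lemma frob_mat_intertwines:
  fixes A :: "'a::finite_field mat"
  assumes A: "A \<in> carrier (GL 2)" and p: "CHAR('a) = p"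
  shows "frob_mat p * sym_mat 1 (map_mat frob A) = sym_mat p A * frob_mat p"
    (is "?P * ?S = ?T * ?P")
proof (rule eq_matI)
  have A2: "A \<in> carrier_mat 2 2" using A by (simp add: carrier_GL)
  have "p > 1" using prime_gt_1_nat[OF CHAR_prime[where ?'a = 'a]] p by simp
  have c: "?P \<in> carrier_mat (p + 1) 2" "?S \<in> carrier_mat 2 2" "?T \<in> carrier_mat (p + 1) (p + 1)"
    using sym_mat_carrier[of 1] sym_mat_carrier[of p A] by (simp_all add: frob_mat_def numeral_2_eq_2)
  fix r j assume "r < dim_row (?T * ?P)" "j < dim_col (?T * ?P)"
  then have rj: "r < p + 1" "j < 2" using c by auto
  have "(?P * ?S) $$ (r, j) = (\<Sum>i<2. ?P $$ (r, i) * frob (A $$ (i, j)))"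
    unfolding mult_mat_index[OF c(1,2) rj] using rj A2
    by (intro sum.cong refl) (simp add: sym_mat_1_index del: One_nat_def)
  also have "\<dots> = Polynomial.coeff ([:A $$ (0, j), A $$ (1, j):] ^ p) r"
    using rj \<open>p > 1\<close> unfolding p[symmetric] linear_power_CHAR
    by (auto simp: frob_mat_def numeral_2_eq_2 coeff_pCons split: nat.splits)
  also have "\<dots> = ?T $$ (r, j * p)"
    using rj by (auto simp: sym_mat_index less_2_cases_iff)
  also have "\<dots> = (\<Sum>i<p + 1. ?T $$ (r, i) * ?P $$ (i, j))"
    using rj by (simp add: frob_mat_def sum_single less_2_cases_iff del: sum.lessThan_Suc) auto
  also have "\<dots> = (?T * ?P) $$ (r, j)"
    using mult_mat_index[OF c(3,1) rj] by simp
  finally show "(?P * ?S) $$ (r, j) = (?T * ?P) $$ (r, j)" .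
qed (auto simp: frob_mat_def sym_mat_def)

text \<open>Since p - j = - j in characteristic p, the product rule for U^(p-j) W^j gives j
  U^(p-j-1) W^(j-1) (A_11 U - A_10 W), and the last factor is the constant det A.\<close>

lemma deriv_mat_intertwines:
  fixes A :: "'a::finite_field mat"
  assumes A: "A \<in> carrier (GL 2)" and p: "CHAR('a) = p"
  shows "deriv_mat p * sym_mat p A = (det A \<cdot>\<^sub>m sym_mat (p - 2) A) * deriv_mat p"
    (is "?Q * ?T = (_ \<cdot>\<^sub>m ?S) * ?Q")
proof (rule eq_matI)
  have "p > 1" using prime_gt_1_nat[OF CHAR_prime[where ?'a = 'a]] p by simp
  have p0: "of_nat p = (0 :: 'a)" using p by (metis of_nat_CHAR)
  have p1: "p - 2 + 1 = p - 1" using \<open>p > 1\<close> by simp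
  have c: "?Q \<in> carrier_mat (p - 1) (p + 1)" "det A \<cdot>\<^sub>m ?S \<in> carrier_mat (p - 1) (p - 1)"
    "?T \<in> carrier_mat (p + 1) (p + 1)" "?S \<in> carrier_mat (p - 1) (p - 1)"
    using sym_mat_carrier[of "p - 2" A, unfolded p1] sym_mat_carrier[of p A] by (simp_all add: deriv_mat_def)
  fix i j assume "i < dim_row ((det A \<cdot>\<^sub>m ?S) * ?Q)" "j < dim_col ((det A \<cdot>\<^sub>m ?S) * ?Q)"
  then have ij: "i < p - 1" "j < p + 1" using c by auto
  let ?U = "[:A $$ (0, 0), A $$ (1, 0):]" and ?W = "[:A $$ (0, 1), A $$ (1, 1):]"
  let ?f = "?U ^ (p - 2 - (j - 1)) * ?W ^ (j - 1)"
  have "(?Q * ?T) $$ (i, j) = of_nat (i + 1) * ?T $$ (i + 1, j)"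
    unfolding mult_mat_index[OF c(1,3) ij] using ij
    by (simp add: deriv_mat_def sum_single del: sum.lessThan_Suc of_nat_Suc)
  also have "\<dots> = Polynomial.coeff (pderiv (?U ^ (p - j) * ?W ^ j)) i"
    using ij by (simp add: sym_mat_index coeff_pderiv)
  also have "pderiv (?U ^ (p - j) * ?W ^ j) = Polynomial.smult (of_nat j * det A) (if j = p then 0 else ?f)"
  proof (cases "0 < j \<and> j < p")
    case True
    define n m where "n = p - j - 1" and "m = j - 1"
    have nm: "p - j = Suc n" "j = Suc m" using True by (auto simp: n_def m_def)
    have "of_nat (Suc n) = (of_nat p - of_nat (Suc m) :: 'a)"
      using nm True by (metis of_nat_diff less_imp_le)
    then have n: "of_nat (Suc n) = (- of_nat (Suc m) :: 'a)" using p0 by simp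
    \<comment> \<open>Stated for arbitrary U and W, so that the linear forms enter the algebra as
      atoms rather than as coefficient lists.\<close>
    have leibniz: "U ^ Suc n * (Polynomial.smult s (W ^ m) * [:d:]) + W ^ Suc m * (Polynomial.smult (- s) (U ^ n) * [:c:])
        = Polynomial.smult s (U ^ n * W ^ m * (Polynomial.smult d U - Polynomial.smult c W))"
      for U W :: "'a poly" and s c d by (simp add: algebra_simps smult_diff_right)
    have "pderiv (?U ^ Suc n * ?W ^ Suc m)
        = Polynomial.smult (of_nat (Suc m)) (?U ^ n * ?W ^ m * (Polynomial.smult (A $$ (1, 1)) ?U - Polynomial.smult (A $$ (1, 0)) ?W))"
      unfolding pderiv_mult pderiv_power_Suc n using leibniz[of ?U "of_nat (Suc m)" ?W] by (simp add: pderiv_pCons)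
    also have "Polynomial.smult (A $$ (1, 1)) ?U - Polynomial.smult (A $$ (1, 0)) ?W = [:det A:]"
      by (simp add: det_2x2[OF A])
    finally show ?thesis using True nm by (simp add: n_def)
  next
    case False
    \<comment> \<open>The two outer columns are p-th powers of a single linear form, whose
      derivative is 0.\<close>
    then have "j = 0 \<or> j = p" using ij by auto
    moreover have "pderiv ([:x, y:] ^ p) = 0" for x y :: 'a
      using \<open>p > 1\<close> p0 by (simp add: pderiv_power)
    ultimately show ?thesis by auto
  qed
  also have "Polynomial.coeff \<dots> i = (if 0 < j \<and> j < p then det A * ?S $$ (i, j - 1) * of_nat j else 0)"
    using ij \<open>p > 1\<close> by (auto simp: sym_mat_index)
  \<comment> \<open>The guard covers j = 0; for j = p the index p - 1 lies outside the sum.\<close>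
  also have "\<dots> = (\<Sum>r<p - 1. (det A * ?S $$ (i, r)) * (if r = j - 1 then if 0 < j then of_nat j else 0 else 0))"
    using ij by (auto simp: sum_single)
  also have "\<dots> = (\<Sum>r<p - 1. (det A \<cdot>\<^sub>m ?S) $$ (i, r) * ?Q $$ (r, j))"
    using ij c(4) by (intro sum.cong refl) (auto simp: deriv_mat_def)
  also have "\<dots> = ((det A \<cdot>\<^sub>m ?S) * ?Q) $$ (i, j)"
    using mult_mat_index[OF c(2,1) ij] by simp
  finally show "(?Q * ?T) $$ (i, j) = ((det A \<cdot>\<^sub>m ?S) * ?Q) $$ (i, j)" .
qed (use prime_gt_1_nat[OF CHAR_prime[where ?'a = 'a]] p in \<open>auto simp: deriv_mat_def sym_mat_def\<close>)

text \<open>Supplies the starting value k = 0 for \<open>M_class_mult_twist_1\<close>.\<close>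

lemma M_class_CHAR:
  assumes p: "CHAR('a::finite_field) = p"
  shows "M_class (int p) = K0_twist 1 (M_class 1) + det_class * (M_class (int p - 2) :: 'a K0)"
proof -
  have "p > 1" using prime_gt_1_nat[OF CHAR_prime[where ?'a = 'a]] p by simp
  let ?F = "rep_twist 1 (Sym_rep 1) :: 'a GL2_rep"
  let ?D = "rep_tensor det_rep (Sym_rep (p - 2)) :: 'a GL2_rep"
  let ?V = "Sym_rep p :: 'a GL2_rep"
  have dims: "rdim ?F = 2" "rdim ?D = p - 1" "rdim ?V = p + 1"
    using \<open>p > 1\<close> by (auto simp: rep_twist Sym_rep det_tensor)
  have fr: "frob_power 1 = (frob :: 'a \<Rightarrow> 'a)" by (simp add: frob_power_def fun_eq_iff)
  have "intertwiner ?F ?V (frob_mat p)" "intertwiner ?V ?D (deriv_mat p)"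
    unfolding intertwiner_def dims
    using frob_mat_intertwines[OF _ p] deriv_mat_intertwines[OF _ p]
    by (auto simp only: rep_twist Sym_rep det_tensor fr) (simp_all add: frob_mat_def deriv_mat_def)
  then have "short_exact ?F ?V ?D"
    unfolding short_exact_split dims using frob_deriv_mat_split[OF p] by blast
  from K0_class_exact[OF this] have "K0_class ?V = K0_class ?F + det_class * K0_class (Sym_rep (p - 2))"
    by (simp only: K0_class_tensor det_class_def)
  then show ?thesis
    using \<open>p > 1\<close> by (simp add: M_class_def K0_twist_class nat_diff_distrib)
qed

section \<open>Twisting the determinant and composing twists\<close>

text \<open>Frobenius is a ring homomorphism and commutes with det. As a power of e, the twisted
  class can be cancelled against the factors produced by reflection.\<close>

lemma K0_twist_det_class: "K0_twist 1 det_class = (det_class ^ CHAR('a) :: 'a::finite_field K0)"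
proof -
  interpret comm_ring_hom "frob :: 'a \<Rightarrow> 'a" by (rule frob_hom)
  have fr: "frob_power 1 = (frob :: 'a \<Rightarrow> 'a)" by (simp add: frob_power_def fun_eq_iff)
  show ?thesis
    unfolding det_class_pow unfolding det_class_def K0_twist_class
    by (intro rep_class_cong) (simp_all only: rep_twist det_rep det_power_rep fr hom_det frob_def)
qed

text \<open>Allows the twist by i to be factored out of the whole theorem. Twists precompose the
  action, so the outer index i is applied to the matrix first.\<close>

lemma K0_twist_plus_1: "K0_twist (i + 1) x = K0_twist i (K0_twist 1 (x :: 'a::finite_field K0))"
proof -
  have inv: "frob (inv_into UNIV frob x) = x" for x :: 'a
    by (rule f_inv_into_f) (use bij_is_surj[OF frob_bij] in auto)
  have "frob_power (i + 1) x = frob (frob_power i x)" for x :: 'a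
  proof (cases "i \<ge> 0")
    case False
    \<comment> \<open>One inverse Frobenius cancels; i = -1 is separate because i + 1 = 0 falls into
      the other branch of \<open>frob_power\<close>.\<close>
    then have "nat (- i) = Suc (nat (- (i + 1)))" by simp
    then show ?thesis using False
      by (cases "i = - 1") (auto simp: frob_power_def inv)
  qed (simp add: frob_power_def nat_add_distrib)
  then have fr: "map_mat (frob_power (i + 1)) A = map_mat (frob_power 1) (map_mat (frob_power i) A)" for A :: "'a mat"
    by (intro eq_matI) (auto simp: frob_power_def[of 1])
  have "rep_twist (i + 1) V = rep_twist i (rep_twist 1 V)" for V :: "'a GL2_rep"
    by (rule rep_eqI) (simp_all add: rep_twist fr)
  then show ?thesis
  proof (transfer fixing: i)
    fix x :: "'a GL2_rep \<Rightarrow>\<^sub>0 int"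
    assume tw: "\<And>V :: 'a GL2_rep. rep_twist (i + 1) V = rep_twist i (rep_twist 1 V)"
    let ?f = "\<lambda>n. frag_extend (\<lambda>V :: 'a GL2_rep. frag_of (rep_twist n V))"
    have "?f (i + 1) x = ?f i (?f 1 x)"
      by (induction x rule: frag_ind) (simp_all add: frag_extend_diff tw)
    then show "?f (i + 1) x - ?f i (?f 1 x) \<in> K0_relations" by (simp add: K0_zero)
  qed
qed

section \<open>Multiplication by the twisted M_1, and the theorem\<close>

text \<open>Two consecutive values determine the sequence upwards, and downwards because e has the
  inverse u; the induction therefore carries pairs.\<close>

lemma second_order_recurrence_unique:
  fixes X Y :: "int \<Rightarrow> 'b::comm_ring_1"
  assumes "u * e = 1"
    and X: "\<And>k. m * X k = X (k + 1) + e * X (k - 1)"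
    and Y: "\<And>k. m * Y k = Y (k + 1) + e * Y (k - 1)"
    and "X (- 1) = Y (- 1)" "X 0 = Y 0"
  shows "X k = Y k"
proof -
  have up: "X (k + 1) = Y (k + 1)" if "X k = Y k" "X (k - 1) = Y (k - 1)" for k
    using X[of k] Y[of k] that by simp
  have down: "X (k - 1) = Y (k - 1)" if "X k = Y k" "X (k + 1) = Y (k + 1)" for k
  proof -
    have "e * X (k - 1) = e * Y (k - 1)" using X[of k] Y[of k] that by simp
    then have "u * e * X (k - 1) = u * e * Y (k - 1)" by (simp add: mult.assoc)
    then show ?thesis using assms(1) by simp
  qed
  have "X k = Y k \<and> X (k - 1) = Y (k - 1)"
  proof (induction k rule: int_induct[where k = 0])
    case base
    show ?case using assms(4,5) by simp
  next
    case (step1 i)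
    then show ?case using up[of i] by simp
  next
    case (step2 i)
    then show ?case using down[of "i - 1"] by simp
  qed
  then show ?thesis ..
qed

text \<open>
  In \<open>k\<close>, both sides satisfy the recurrence \<open>X\<^sub>k\<^sub>+\<^sub>1 = M\<^sub>1 X\<^sub>k - e X\<^sub>k\<^sub>-\<^sub>1\<close>, so the cases \<open>k = -1, 0\<close> suffice.
\<close>

lemma M_class_mult_twist_1:
  assumes p: "CHAR('a::finite_field) = p"
  shows "M_class k * K0_twist 1 (M_class 1)
    = M_class (k + int p) + K0_twist 1 det_class * (M_class (k - int p) :: 'a K0)"
proof -
  have e0: "det_class_power 0 = (1 :: 'a K0)" using det_class_power_nat[of 0, where ?'a = 'a] by simp
  have ep: "K0_twist 1 det_class = (det_class_power (int p) :: 'a K0)"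
    by (simp add: K0_twist_det_class p det_class_power_nat)
  show ?thesis
  proof (rule second_order_recurrence_unique[where m = "M_class 1" and e = det_class
        and u = "det_class_power (- 1)" and X = "\<lambda>k. M_class k * K0_twist 1 (M_class 1)"
        and Y = "\<lambda>k. M_class (k + int p) + K0_twist 1 det_class * M_class (k - int p)"])
    show "det_class_power (- 1) * det_class = (1 :: 'a K0)"
      unfolding det_class_power_1[symmetric] by (simp add: e0 flip: det_class_power_add)
    fix k
    show "M_class 1 * (M_class k * K0_twist 1 (M_class 1)) = M_class (k + 1) * K0_twist 1 (M_class 1)
        + det_class * (M_class (k - 1) * (K0_twist 1 (M_class 1) :: 'a K0))"
      unfolding mult.assoc[symmetric] M_class_1_mult by (simp add: distrib_right)
    have "M_class 1 * (M_class (k + int p) + K0_twist 1 det_class * M_class (k - int p))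
        = M_class 1 * M_class (k + int p) + K0_twist 1 det_class * (M_class 1 * (M_class (k - int p) :: 'a K0))"
      by (simp add: algebra_simps)
    also have "\<dots> = M_class (k + 1 + int p) + K0_twist 1 det_class * M_class (k + 1 - int p)
        + det_class * (M_class (k - 1 + int p) + K0_twist 1 det_class * M_class (k - 1 - int p))"
      unfolding M_class_1_mult by (simp add: algebra_simps)
    finally show "M_class 1 * (M_class (k + int p) + K0_twist 1 det_class * M_class (k - int p)) = \<dots>" .
  next
    \<comment> \<open>Case k = -1: the left side is 0, and reflecting p - 1 gives e^p M_(-1-p) = -
      M_(p-1).\<close>
    have "M_class (- 1 - int p) = - (det_class_power (- int p) * (M_class (int p - 1) :: 'a K0))"
      using M_class_reflect[of "int p - 1", where ?'a = 'a] by simp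
    then have "K0_twist 1 det_class * M_class (- 1 - int p) = - (M_class (int p - 1) :: 'a K0)"
      by (simp add: ep e0 mult.assoc[symmetric] flip: det_class_power_add)
    then show "M_class (- 1) * K0_twist 1 (M_class 1)
        = M_class (- 1 + int p) + K0_twist 1 det_class * (M_class (- 1 - int p) :: 'a K0)"
      by (simp add: M_class_def[of "- 1"])
  next
    \<comment> \<open>Case k = 0: reflecting p - 2 leaves e^p e^(1-p) = e, which reduces the claim
      to \<open>M_class_CHAR\<close>.\<close>
    have "M_class (- int p) = - (det_class_power (1 - int p) * (M_class (int p - 2) :: 'a K0))"
      using M_class_reflect[of "int p - 2", where ?'a = 'a] by simp
    then have "K0_twist 1 det_class * M_class (- int p) = - (det_class * (M_class (int p - 2) :: 'a K0))"
      unfolding ep by (simp add: mult.assoc[symmetric] det_class_power_1 flip: det_class_power_add)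
    then show "M_class 0 * K0_twist 1 (M_class 1)
        = M_class (0 + int p) + K0_twist 1 det_class * (M_class (0 - int p) :: 'a K0)"
      by (simp add: M_class_0 M_class_CHAR[OF p])
  qed
qed

theorem corollary3p3:
  fixes p g :: nat and k h i :: int
  assumes "prime p" and "g \<ge> 1" and "CARD('a::finite_field) = p ^ g"
  shows "K0_twist i (M_class k) * K0_twist (i + 1) (M_class h)
       - K0_twist (i + 1) det_class
         * K0_twist i (M_class (k - int p)) * K0_twist (i + 1) (M_class (h - 1))
       = (K0_twist i (M_class (k - int p)) * K0_twist (i + 1) (M_class (h + 1))
       - K0_twist (i + 1) det_class
         * K0_twist i (M_class (k - 2 * int p)) * K0_twist (i + 1) (M_class h) :: 'a K0)"
proof -
  have p: "CHAR('a) = p" by (rule CHAR_eq_of_CARD) fact+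
  interpret F: comm_ring_hom "K0_twist 1 :: 'a K0 \<Rightarrow> 'a K0" by (rule K0_twist_hom)
  interpret T: comm_ring_hom "K0_twist i :: 'a K0 \<Rightarrow> 'a K0" by (rule K0_twist_hom)
  let ?F = "K0_twist 1 :: 'a K0 \<Rightarrow> 'a K0" and ?m = "M_class (k - int p) :: 'a K0"
  \<comment> \<open>The twisted recurrence in h expands one pairing of the triple product;
    \<open>M_class_mult_twist_1\<close> at k - p expands the other.\<close>
  have "?m * (?F (M_class (h + 1)) + ?F det_class * ?F (M_class (h - 1))) = ?m * (?F (M_class 1) * ?F (M_class h))"
    by (simp add: M_class_1_mult F.hom_add flip: F.hom_mult)
  also have "\<dots> = (M_class k + ?F det_class * M_class (k - 2 * int p)) * ?F (M_class h)"
  proof -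
    have "k - int p - int p = k - 2 * int p" by simp
    then show ?thesis
      using M_class_mult_twist_1[OF p, of "k - int p"] by (simp add: mult.assoc[symmetric])
  qed
  finally have "M_class k * ?F (M_class h) - ?F det_class * ?m * ?F (M_class (h - 1))
      = ?m * ?F (M_class (h + 1)) - ?F det_class * M_class (k - 2 * int p) * ?F (M_class h)"
    by (simp add: algebra_simps)
  \<comment> \<open>So far this is the case i = 0; the ring homomorphism \<open>K0_twist i\<close>
    carries it to every i.\<close>
  from arg_cong[OF this, of "K0_twist i"] show ?thesis
    by (simp add: K0_twist_plus_1 T.hom_minus T.hom_mult)
qed

end
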